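(* For every integer $n\ge 5$, the four sequences $(B_{n,k})_{k=0}^{n-1}$, $(C_{n,k})_{k=0}^{n-1}$, $(P_{n,k})_{k=0}^{n-1}$, $(Q_{n,k})_{k=0}^{n-1}$ are ultra-synchronised; that is, for every $1\le i\le n-2$, $$\frac{\min(B_{n,i},C_{n,i},P_{n,i},Q_{n,i})^2}{\binom{n-1}{i}^2}\ \ge\ \frac{\max(B_{n,i+1},C_{n,i+1},P_{n,i+1},Q_{n,i+1})}{\binom{n-1}{i+1}}\cdot\frac{\max(B_{n,i-1},C_{n,i-1},P_{n,i-1},Q_{n,i-1})}{\binom{n-1}{i-1}}.$$
   Context: For a permutation $\pi=\pi_1\pi_2\cdots\pi_n$ of $[n]=\{1,\dots,n\}$, the number of descents is $\mathrm{des}(\pi)=|\{i\in[n-1]:\pi_i>\pi_{i+1}\}|$ and the number of excedances is $\mathrm{exc}(\pi)=|\{i\in[n]:\pi_i>i\}|$. $B_{n,k}$ (resp. $C_{n,k}$) is the number of even (resp. odd) permutations of $[n]$ with exactly $k$ descents; $P_{n,k}$ (resp. $Q_{n,k}$) is the number of even (resp. odd) permutations of $[n]$ with exactly $k$ excedances. Sequences $(X^{(j)}_k)_{k=0}^{m}$, $1\le j\le r$, of real numbers are called ultra-synchronised at an index $i$ with $1\le i\le m-1$ if $$\frac{\min(X^{(1)}_i,\dots,X^{(r)}_i)^2}{\binom{m}{i}^2}\ge\frac{\max(X^{(1)}_{i+1},\dots,X^{(r)}_{i+1})}{\binom{m}{i+1}}\cdot\frac{\max(X^{(1)}_{i-1},\dots,X^{(r)}_{i-1})}{\binom{m}{i-1}},$$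 and ultra-synchronised if this holds at every index $1\le i\le m-1$. *)

theory Defs
  imports Complex_Main "HOL-Combinatorics.Permutations"
begin

definition des :: "nat \<Rightarrow> (nat \<Rightarrow> nat) \<Rightarrow> nat"
  where "des n \<pi> = card {i \<in> {1..n - 1}. \<pi> i > \<pi> (i + 1)}"

definition exc :: "nat \<Rightarrow> (nat \<Rightarrow> nat) \<Rightarrow> nat"
  where "exc n \<pi> = card {i \<in> {1..n}. \<pi> i > i}"

definition B_num :: "nat \<Rightarrow> nat \<Rightarrow> nat"
  where "B_num n k = card {\<pi>. \<pi> permutes {1..n} \<and> evenperm \<pi> \<and> des n \<pi> = k}"

definition C_num :: "nat \<Rightarrow> nat \<Rightarrow> nat"
  where "C_num n k = card {\<pi>. \<pi> permutes {1..n} \<and> \<not> evenperm \<pi> \<and> des n \<pi> = k}"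

definition P_num :: "nat \<Rightarrow> nat \<Rightarrow> nat"
  where "P_num n k = card {\<pi>. \<pi> permutes {1..n} \<and> evenperm \<pi> \<and> exc n \<pi> = k}"

definition Q_num :: "nat \<Rightarrow> nat \<Rightarrow> nat"
  where "Q_num n k = card {\<pi>. \<pi> permutes {1..n} \<and> \<not> evenperm \<pi> \<and> exc n \<pi> = k}"

text \<open>
  A nonempty list \<open>Xs\<close> holds the \<open>r\<close> sequences; only the entries with index \<open>0, \<dots>, m\<close> matter.
\<close>

definition ultra_synchronised_at :: "nat \<Rightarrow> (nat \<Rightarrow> real) list \<Rightarrow> nat \<Rightarrow> bool"
  where "ultra_synchronised_at m Xs i \<longleftrightarrow>
    (MIN X\<in>set Xs. X i)\<^sup>2 / (real (m choose i))\<^sup>2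
      \<ge> (MAX X\<in>set Xs. X (i + 1)) / real (m choose (i + 1))
        * ((MAX X\<in>set Xs. X (i - 1)) / real (m choose (i - 1)))"

definition ultra_synchronised :: "nat \<Rightarrow> (nat \<Rightarrow> real) list \<Rightarrow> bool"
  where "ultra_synchronised m Xs \<longleftrightarrow> (\<forall>i\<in>{1..m - 1}. ultra_synchronised_at m Xs i)"

end

theory Submission
  imports Defs
begin

text \<open>
  Write \<open>A\<close> for the Eulerian numbers. Each of the four sequences is half of \<open>A \<plusminus> d\<close>, where \<open>d\<close> is the
  corresponding signed count. For excedances \<open>\<Sum> sign \<pi> t^exc = (1 - t)^(n - 1)\<close>. For descents,
  exchanging the values \<open>n + 1\<close> and \<open>n + 2\<close> cancels all permutations of \<open>[n + 2]\<close> in which they are not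
  adjacent; the others arise by inserting a block of two maximal letters into a permutation of \<open>[n]\<close>,
  so the signed polynomial for \<open>n + 2\<close> is \<open>1 - t\<close> times one Eulerian step applied to that for \<open>n\<close>.

  The numbers \<open>A(n, k) / (n - 1 choose k)\<close> are log-concave with the extra factor \<open>1 + 2 / (n - 1)\<close>, by
  induction from the Eulerian recurrence. For \<open>n \<ge> 8\<close> and \<open>0 < k < n - 1\<close> the perturbation satisfies
  \<open>\<bar>d\<bar> \<le> A / (2 n)\<close>, which this factor absorbs. When a neighbouring index is \<open>0\<close> or \<open>n - 1\<close>, where
  \<open>\<bar>d\<bar> = A = 1\<close>, the bound \<open>A(n, 1)^2 \<ge> 7 A(n, 2)\<close> is used instead, and \<open>n = 5, 6, 7\<close> is a computation.
\<close>

section \<open>Descents\<close>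

text \<open>On generating polynomials this is
  \<open>a(t) -> (1 + n t) a(t) + t (1 - t) a'(t)\<close>, which takes the Eulerian polynomial of
  \<open>[n]\<close> to that of \<open>[n + 1]\<close>.\<close>

definition eulerian_step :: "nat \<Rightarrow> (nat \<Rightarrow> int) \<Rightarrow> nat \<Rightarrow> int" where
  "eulerian_step n a k =
    (int k + 1) * a k + (if k = 0 then 0 else (int n + 1 - int k) * a (k - 1))"

fun eulerian :: "nat \<Rightarrow> nat \<Rightarrow> int" where
  "eulerian 0 k = (if k = 0 then 1 else 0)"
| "eulerian (Suc n) k = eulerian_step n (eulerian n) k"

fun signed_eulerian :: "nat \<Rightarrow> nat \<Rightarrow> int" where
  "signed_eulerian 0 k = (if k = 0 then 1 else 0)"
| "signed_eulerian (Suc 0) k = (if k = 0 then 1 else 0)"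
| "signed_eulerian (Suc (Suc n)) k =
    eulerian_step n (signed_eulerian n) k
    - (if k = 0 then 0 else eulerian_step n (signed_eulerian n) (k - 1))"

section \<open>Insertion of a largest letter: effect on sign and descents\<close>

abbreviation perms :: "nat \<Rightarrow> (nat \<Rightarrow> nat) set" where
  "perms n \<equiv> {\<pi>. \<pi> permutes {1..n}}"

definition shift_cycle :: "nat \<Rightarrow> nat \<Rightarrow> nat \<Rightarrow> nat" where
  "shift_cycle n p i =
    (if i < p then i else if i = p then Suc n else if i \<le> Suc n then i - 1 else i)"

text \<open>In one-line notation, the letter \<open>n + 1\<close> is put at position
  \<open>p\<close> of the word of \<open>\<pi>\<close> and the later letters move one place to the
  right.\<close>

definition insert_max :: "nat \<Rightarrow> nat \<Rightarrow> (nat \<Rightarrow> nat) \<Rightarrow> nat \<Rightarrow> nat" where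
  "insert_max n p \<pi> = \<pi> \<circ> shift_cycle n p"

definition descents :: "nat \<Rightarrow> (nat \<Rightarrow> nat) \<Rightarrow> nat set" where
  "descents n \<pi> = {i \<in> {1..n - 1}. \<pi> i > \<pi> (i + 1)}"

lemma finite_descents [simp]: "finite (descents n \<pi>)"
  by (simp add: descents_def)

lemma des_eq_card_descents: "des n \<pi> = card (descents n \<pi>)"
  by (simp add: des_def descents_def)

lemma shift_cycle_permutes:
  assumes "p \<in> {1..Suc n}"
  shows "shift_cycle n p permutes {1..Suc n}"
proof (rule bij_imp_permutes)
  have inj: "inj_on (shift_cycle n p) {1..Suc n}"
    using assms by (auto simp: inj_on_def shift_cycle_def split: if_splits)
  moreover have "shift_cycle n p ` {1..Suc n} \<subseteq> {1..Suc n}"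
    using assms by (auto simp: shift_cycle_def)
  ultimately show "bij_betw (shift_cycle n p) {1..Suc n} {1..Suc n}"
    by (simp add: bij_betw_def endo_inj_surj)
qed (use assms in \<open>auto simp: shift_cycle_def\<close>)

text \<open>Induction downwards from \<open>p = Suc n\<close>, where the map is the identity;
  lowering \<open>p\<close> by one costs one adjacent transposition.\<close>

lemma sign_shift_cycle:
  assumes "p \<in> {1..Suc n}"
  shows "sign (shift_cycle n p) = (-1) ^ (Suc n - p)"
proof -
  have "p \<le> Suc n" using assms by simp
  then show ?thesis using assms
  proof (induction rule: inc_induct)
    case base
    have "shift_cycle n (Suc n) = id" by (auto simp: shift_cycle_def fun_eq_iff)
    then show ?case by (simp add: sign_id)
  next
    case (step p)
    have eq: "shift_cycle n p = shift_cycle n (Suc p) \<circ> transpose p (Suc p)"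
      using step by (auto simp: shift_cycle_def fun_eq_iff transpose_def)
    have "permutation (shift_cycle n (Suc p))"
      using shift_cycle_permutes[of "Suc p" n] step by (auto simp: permutation_permutes)
    then have "sign (shift_cycle n p) = - sign (shift_cycle n (Suc p))"
      unfolding eq by (simp add: sign_compose permutation_swap_id sign_swap_id)
    with step show ?case by (simp add: Suc_diff_le)
  qed
qed

lemma permutes_Suc: "\<pi> permutes {1..n} \<Longrightarrow> \<pi> permutes {1..Suc n}"
  by (rule permutes_subset) auto

lemma permutes_gt: "\<pi> permutes {1..n} \<Longrightarrow> (n :: nat) < i \<Longrightarrow> \<pi> i = i"
  by (rule permutes_not_in) auto

lemma permutes_le: "\<pi> permutes {1..n} \<Longrightarrow> (1 :: nat) \<le> i \<Longrightarrow> i \<le> n \<Longrightarrow> \<pi> i \<le> n"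
  using permutes_in_image[of \<pi> "{1..n}" i] by auto

lemma insert_max_permutes:
  "\<pi> permutes {1..n} \<Longrightarrow> p \<in> {1..Suc n} \<Longrightarrow> insert_max n p \<pi> permutes {1..Suc n}"
  unfolding insert_max_def
  by (intro permutes_compose shift_cycle_permutes permutes_Suc)

lemma sign_insert_max:
  assumes "\<pi> permutes {1..n}" "p \<in> {1..Suc n}"
  shows "sign (insert_max n p \<pi>) = (-1) ^ (Suc n - p) * sign \<pi>"
  unfolding insert_max_def using assms shift_cycle_permutes[OF assms(2)]
  by (subst sign_compose) (auto simp: permutation_permutes sign_shift_cycle)

lemma insert_max_apply:
  assumes "\<pi> permutes {1..n}"
  shows "insert_max n p \<pi> i =
    (if i < p then \<pi> i else if i = p then Suc n else if i \<le> Suc n then \<pi> (i - 1) else i)"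
  using permutes_gt[OF assms] by (auto simp: insert_max_def shift_cycle_def)

text \<open>The position of the value \<open>n + 1\<close> recovers \<open>p\<close>, and cancelling
  the cycle recovers \<open>\<pi>\<close>; surjectivity then follows from
  \<open>n! (n + 1) = (n + 1)!\<close>.\<close>

lemma bij_betw_insert_max:
  "bij_betw (\<lambda>(\<pi>, p). insert_max n p \<pi>) (perms n \<times> {1..Suc n}) (perms (Suc n))"
proof -
  let ?F = "\<lambda>(\<pi>, p). insert_max n p \<pi>"
  have inj: "inj_on ?F (perms n \<times> {1..Suc n})"
  proof (rule inj_onI, clarify)
    fix \<pi> p \<sigma> q
    assume \<pi>: "\<pi> permutes {1..n}" and \<sigma>: "\<sigma> permutes {1..n}"
      and p: "p \<in> {1..Suc n}" and q: "q \<in> {1..Suc n}"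
      and eq: "insert_max n p \<pi> = insert_max n q \<sigma>"
    have "insert_max n p \<pi> p = Suc n" "insert_max n q \<sigma> q = Suc n"
      by (simp_all add: insert_max_apply[OF \<pi>] insert_max_apply[OF \<sigma>])
    then have "insert_max n p \<pi> p = insert_max n p \<pi> q" by (simp add: eq)
    then have "p = q"
      using permutes_inj[OF insert_max_permutes[OF \<pi> p]] by (simp add: inj_eq)
    moreover from this have "\<pi> = \<sigma>"
      using eq permutes_surj[OF shift_cycle_permutes[OF q]]
      by (auto simp: insert_max_def fun_eq_iff) (metis surjD)
    ultimately show "\<pi> = \<sigma> \<and> p = q" by simp
  qed
  have "?F ` (perms n \<times> {1..Suc n}) = perms (Suc n)"
  proof (rule card_subset_eq)
    show "?F ` (perms n \<times> {1..Suc n}) \<subseteq> perms (Suc n)"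
      using insert_max_permutes by auto
    have "card (perms n) = fact n" "card (perms (Suc n)) = fact (Suc n)"
      by (rule card_permutations; simp)+
    then show "card (?F ` (perms n \<times> {1..Suc n})) = card (perms (Suc n))"
      by (subst card_image[OF inj]) (simp add: card_cartesian_product)
  qed (simp add: finite_permutations)
  with inj show ?thesis by (simp add: bij_betw_def)
qed

lemma sum_perms_Suc:
  "(\<Sum>\<tau>\<in>perms (Suc n). g \<tau>) = (\<Sum>\<pi>\<in>perms n. \<Sum>p\<in>{1..Suc n}. g (insert_max n p \<pi>))"
  unfolding sum.cartesian_product
  by (subst sum.reindex_bij_betw[OF bij_betw_insert_max, symmetric]) (simp only: split_def)

text \<open>The new letter exceeds all others: it creates a descent at \<open>p\<close> unless it
  comes last, and it removes any descent at \<open>p - 1\<close>. Descents further right move up by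
  one.\<close>

lemma descents_insert_max:
  assumes \<pi>: "\<pi> permutes {1..n}" and p: "p \<in> {1..Suc n}"
  shows "descents (Suc n) (insert_max n p \<pi>) =
    {i \<in> descents n \<pi>. Suc i < p} \<union> (if p \<le> n then {p} else {}) \<union> Suc ` {i \<in> descents n \<pi>. p \<le> i}"
    (is "?L = ?R")
proof (rule set_eqI)
  fix i
  consider "Suc i < p" | "Suc i = p" | "i = p" | "p < i" by linarith
  then show "i \<in> ?L \<longleftrightarrow> i \<in> ?R"
  proof cases
    case 1
    then show ?thesis using p by (auto simp: descents_def insert_max_apply[OF \<pi>])
  next
    case 2
    then show ?thesis using p permutes_le[OF \<pi>, of i]
      by (auto simp: descents_def insert_max_apply[OF \<pi>])
  next
    case 3
    then show ?thesis using p permutes_le[OF \<pi>, of i]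
      by (auto simp: descents_def insert_max_apply[OF \<pi>])
  next
    case 4
    then obtain j where j: "i = Suc j" by (cases i) auto
    with 4 show ?thesis using p
      by (auto simp: descents_def insert_max_apply[OF \<pi>])
  qed
qed

text \<open>The descent created at \<open>p\<close> is a net gain unless the insertion splits an
  existing descent. For \<open>p = 1\<close> the index \<open>p - 1 = 0\<close> is never a
  descent.\<close>

lemma des_insert_max:
  assumes \<pi>: "\<pi> permutes {1..n}" and p: "p \<in> {1..Suc n}"
  shows "des (Suc n) (insert_max n p \<pi>) =
    des n \<pi> + (if p = Suc n \<or> p - 1 \<in> descents n \<pi> then 0 else 1)"
proof -
  let ?D = "descents n \<pi>"
  have D: "?D \<subseteq> {1..n - 1}" by (auto simp: descents_def)
  have "des n \<pi> = card ({i \<in> ?D. Suc i < p} \<union> {i \<in> ?D. p \<le> i} \<union> {i \<in> ?D. Suc i = p})"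
    unfolding des_eq_card_descents by (rule arg_cong[where f = card]) auto
  also have "\<dots> = card {i \<in> ?D. Suc i < p} + card {i \<in> ?D. p \<le> i} + card {i \<in> ?D. Suc i = p}"
    by (subst card_Un_disjoint; (subst card_Un_disjoint)?) auto
  also have "{i \<in> ?D. Suc i = p} = (if p - 1 \<in> ?D then {p - 1} else {})"
    using D p by auto
  finally have d: "des n \<pi> = card {i \<in> ?D. Suc i < p} + card {i \<in> ?D. p \<le> i}
    + (if p - 1 \<in> ?D then 1 else 0)" by simp
  have "des (Suc n) (insert_max n p \<pi>) =
    card {i \<in> ?D. Suc i < p} + (if p \<le> n then 1 else 0) + card {i \<in> ?D. p \<le> i}"
    unfolding des_eq_card_descents descents_insert_max[OF assms]
    by (subst card_Un_disjoint; (subst card_Un_disjoint)?) (auto simp: card_image)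
  moreover have "p - 1 \<in> ?D \<Longrightarrow> p \<le> n" using D p by fastforce
  ultimately show ?thesis using d p by (auto split: if_splits)
qed

lemma des_le: "des n \<pi> \<le> n - 1"
proof -
  have "card (descents n \<pi>) \<le> card {1..n - 1}" by (rule card_mono) (auto simp: descents_def)
  then show ?thesis by (simp add: des_eq_card_descents)
qed

text \<open>Of the \<open>n + 1\<close> places, the last one and those splitting a descent keep the
  descent number, and the others raise it by one. A general \<open>f\<close> serves both the plain
  indicator and the difference that arises in the signed case.\<close>

lemma sum_des_insert_max:
  fixes f :: "nat \<Rightarrow> int"
  assumes \<pi>: "\<pi> permutes {1..n}"
  shows "(\<Sum>p\<in>{1..Suc n}. f (des (Suc n) (insert_max n p \<pi>))) =
    (int (des n \<pi>) + 1) * f (des n \<pi>) + (int n - int (des n \<pi>)) * f (Suc (des n \<pi>))"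
proof -
  let ?D = "descents n \<pi>"
  \<comment> \<open>A descent at \<open>i\<close> is split by inserting at position
    \<open>i + 1\<close>, hence the successor.\<close>
  let ?S = "insert (Suc n) (Suc ` ?D)"
  have sub: "?S \<subseteq> {1..Suc n}" by (auto simp: descents_def)
  have cS: "card ?S = Suc (des n \<pi>)"
    by (subst card_insert_disjoint) (auto simp: card_image des_eq_card_descents descents_def)
  have "(\<Sum>p\<in>{1..Suc n}. f (des (Suc n) (insert_max n p \<pi>))) =
      (\<Sum>p\<in>{1..Suc n}. if p \<in> ?S then f (des n \<pi>) else f (Suc (des n \<pi>)))"
  proof (rule sum.cong)
    fix p assume p: "p \<in> {1..Suc n}"
    then have "p \<in> ?S \<longleftrightarrow> p = Suc n \<or> p - 1 \<in> ?D"
      by (cases p) auto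
    then show "f (des (Suc n) (insert_max n p \<pi>)) =
      (if p \<in> ?S then f (des n \<pi>) else f (Suc (des n \<pi>)))"
      by (simp add: des_insert_max[OF \<pi> p])
  qed simp
  also have "\<dots> = (\<Sum>p\<in>?S. f (des n \<pi>)) + (\<Sum>p\<in>{1..Suc n} - ?S. f (Suc (des n \<pi>)))"
  proof -
    have "{1..Suc n} \<inter> {p. p \<in> ?S} = ?S" "{1..Suc n} \<inter> - {p. p \<in> ?S} = {1..Suc n} - ?S"
      using sub by auto
    then show ?thesis by (simp only: sum.If_cases finite_atLeastAtMost)
  qed
  also have "card ({1..Suc n} - ?S) = n - des n \<pi>"
    using sub cS by (subst card_Diff_subset) auto
  then have "(\<Sum>p\<in>{1..Suc n} - ?S. f (Suc (des n \<pi>))) = (int n - int (des n \<pi>)) * f (Suc (des n \<pi>))"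
    using des_le[of n \<pi>] by (simp add: of_nat_diff)
  finally show ?thesis using cS by (simp add: algebra_simps)
qed

text \<open>Turns the contribution of each single permutation into the recurrence for the weighted
  counts. The weight \<open>w\<close> is \<open>1\<close> for plain counts and the sign for signed
  ones.\<close>

lemma sum_indicator_step:
  fixes w :: "'a \<Rightarrow> int" and d :: "'a \<Rightarrow> nat"
  shows "(\<Sum>x\<in>S. w x * ((int (d x) + 1) * of_bool (d x = k)
      + (int n - int (d x)) * of_bool (Suc (d x) = k)))
    = eulerian_step n (\<lambda>j. \<Sum>x\<in>S. w x * of_bool (d x = j)) k"
proof -
  have "w x * ((int (d x) + 1) * of_bool (d x = k) + (int n - int (d x)) * of_bool (Suc (d x) = k))
    = (int k + 1) * (w x * of_bool (d x = k)) +
      (if k = 0 then 0 else (int n + 1 - int k) * (w x * of_bool (d x = k - 1)))" for x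
    by (cases k) (auto simp: algebra_simps)
  then show ?thesis
    unfolding eulerian_step_def sum_distrib_left
    by (cases "k = 0") (simp_all only: sum.distrib if_True if_False sum.neutral_const refl)
qed

text \<open>The factor \<open>1\<close> makes the sum an instance of
  \<open>sum_indicator_step\<close>.\<close>

lemma sum_des_eulerian: "(\<Sum>\<pi>\<in>perms n. 1 * of_bool (des n \<pi> = k)) = eulerian n k"
proof (induction n arbitrary: k)
  case 0
  then show ?case by (simp add: des_def)
next
  case (Suc n)
  have "(\<Sum>\<pi>\<in>perms (Suc n). 1 * of_bool (des (Suc n) \<pi> = k) :: int) = (\<Sum>\<pi>\<in>perms n.
    1 * ((int (des n \<pi>) + 1) * of_bool (des n \<pi> = k) + (int n - int (des n \<pi>)) * of_bool (Suc (des n \<pi>) = k)))"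
    unfolding sum_perms_Suc mult_1
    using sum_des_insert_max[of _ n "\<lambda>d. of_bool (d = k)"] by (intro sum.cong refl) auto
  also have "\<dots> = eulerian_step n (eulerian n) k"
    unfolding sum_indicator_step Suc ..
  finally show ?case by simp
qed

section \<open>Cancellation in the signed descent count by exchanging the two largest values\<close>

lemma inv_insert_max:
  assumes \<pi>: "\<pi> permutes {1..n}" and p: "p \<in> {1..Suc n}"
  shows "inv (insert_max n p \<pi>) (Suc n) = p"
  using permutes_inj[OF insert_max_permutes[OF assms]]
  by (rule inv_f_eq) (simp add: insert_max_apply[OF \<pi>])

definition top_adjacent :: "nat \<Rightarrow> (nat \<Rightarrow> nat) \<Rightarrow> bool" where
  "top_adjacent n \<tau> \<longleftrightarrow>
    inv \<tau> (Suc (Suc n)) = Suc (inv \<tau> (Suc n)) \<or> inv \<tau> (Suc n) = Suc (inv \<tau> (Suc (Suc n)))"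

text \<open>Inserting at \<open>q \<le> p\<close> pushes \<open>n + 1\<close> to position
  \<open>p + 1\<close>. So \<open>q = p\<close> puts \<open>n + 2\<close> immediately before
  \<open>n + 1\<close>, and \<open>q = p + 1\<close> immediately after it.\<close>

lemma top_adjacent_insert_max:
  assumes \<sigma>: "\<sigma> permutes {1..n}" and p: "p \<in> {1..Suc n}" and q: "q \<in> {1..Suc (Suc n)}"
  shows "top_adjacent n (insert_max (Suc n) q (insert_max n p \<sigma>)) \<longleftrightarrow> q = p \<or> q = Suc p"
proof -
  note \<pi> = insert_max_permutes[OF \<sigma> p]
  have "inv (insert_max (Suc n) q (insert_max n p \<sigma>)) (Suc n) = (if p < q then p else Suc p)"
    using permutes_inj[OF insert_max_permutes[OF \<pi> q]] p
    by (intro inv_f_eq) (auto simp: insert_max_apply[OF \<pi>] insert_max_apply[OF \<sigma>])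
  then show ?thesis
    by (auto simp: top_adjacent_def inv_insert_max[OF \<pi> q])
qed

lemma top_transpose_permutes:
  "transpose (Suc n) (Suc (Suc n)) permutes {1..Suc (Suc n)}"
  by (rule permutes_swap_id) auto

lemma top_adjacent_transpose:
  assumes "\<tau> permutes {1..Suc (Suc n)}"
  shows "top_adjacent n (transpose (Suc n) (Suc (Suc n)) \<circ> \<tau>) \<longleftrightarrow> top_adjacent n \<tau>"
proof -
  have "inv (transpose (Suc n) (Suc (Suc n)) \<circ> \<tau>) = inv \<tau> \<circ> transpose (Suc n) (Suc (Suc n))"
    using permutes_bij[OF assms] by (subst o_inv_distrib) auto
  then show ?thesis by (auto simp: top_adjacent_def)
qed

text \<open>The two largest values compare alike with every other value, so only a comparison
  between themselves could change, and none occurs when they are not neighbours.\<close>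

lemma des_transpose_top:
  assumes \<tau>: "\<tau> permutes {1..Suc (Suc n)}" and na: "\<not> top_adjacent n \<tau>"
  shows "des (Suc (Suc n)) (transpose (Suc n) (Suc (Suc n)) \<circ> \<tau>) = des (Suc (Suc n)) \<tau>"
proof -
  have "transpose (Suc n) (Suc (Suc n)) (\<tau> i) > transpose (Suc n) (Suc (Suc n)) (\<tau> (Suc i))
    \<longleftrightarrow> \<tau> i > \<tau> (Suc i)" if "i \<in> {1..Suc n}" for i
  proof -
    have "\<tau> i \<le> Suc (Suc n)" "\<tau> (Suc i) \<le> Suc (Suc n)" "\<tau> i \<noteq> \<tau> (Suc i)"
      using that permutes_le[OF \<tau>, of i] permutes_le[OF \<tau>, of "Suc i"] permutes_inj[OF \<tau>]
      by (auto simp: inj_eq)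
    moreover have "\<not> (\<tau> i = Suc n \<and> \<tau> (Suc i) = Suc (Suc n))"
      "\<not> (\<tau> i = Suc (Suc n) \<and> \<tau> (Suc i) = Suc n)"
      using na permutes_inverses(2)[OF \<tau>, of i] permutes_inverses(2)[OF \<tau>, of "Suc i"]
      by (auto simp: top_adjacent_def)
    ultimately show ?thesis by (auto simp: transpose_def)
  qed
  then have "{i \<in> {1..Suc (Suc n) - 1}. (transpose (Suc n) (Suc (Suc n)) \<circ> \<tau>) i
      > (transpose (Suc n) (Suc (Suc n)) \<circ> \<tau>) (i + 1)} = {i \<in> {1..Suc (Suc n) - 1}. \<tau> i > \<tau> (i + 1)}"
    by auto
  then show ?thesis by (simp add: des_def)
qed

lemma sign_transpose_top:
  assumes "\<tau> permutes {1..Suc (Suc n)}"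
  shows "sign (transpose (Suc n) (Suc (Suc n)) \<circ> \<tau>) = - sign \<tau>"
  using permutes_imp_permutation[OF _ assms]
  by (simp add: sign_compose permutation_swap_id sign_swap_id)

text \<open>Exchanging the two largest values is a sign-reversing involution on this set that
  preserves \<open>des\<close>, so the sum equals its own negative.\<close>

lemma sum_not_top_adjacent:
  fixes f :: "nat \<Rightarrow> int"
  shows "(\<Sum>\<tau>\<in>{\<tau> \<in> perms (Suc (Suc n)). \<not> top_adjacent n \<tau>}. sign \<tau> * f (des (Suc (Suc n)) \<tau>)) = 0"
    (is "sum ?g ?S = 0")
proof -
  let ?t = "transpose (Suc n) (Suc (Suc n))"
  have "sum ?g ?S = (\<Sum>\<tau>\<in>?S. - ?g \<tau>)"
  proof (rule sum.reindex_bij_witness[where i = "\<lambda>\<tau>. ?t \<circ> \<tau>" and j = "\<lambda>\<tau>. ?t \<circ> \<tau>"])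
    fix \<tau> assume "\<tau> \<in> ?S"
    then have \<tau>: "\<tau> permutes {1..Suc (Suc n)}" "\<not> top_adjacent n \<tau>" by auto
    show "?t \<circ> (?t \<circ> \<tau>) = \<tau>" by (simp add: fun_eq_iff)
    then show "?t \<circ> (?t \<circ> \<tau>) = \<tau>" .
    show "?t \<circ> \<tau> \<in> ?S"
      using \<tau> top_adjacent_transpose[OF \<tau>(1)] permutes_compose[OF \<tau>(1) top_transpose_permutes]
      by blast
    then show "?t \<circ> \<tau> \<in> ?S" .
    show "- ?g (?t \<circ> \<tau>) = ?g \<tau>"
      by (simp add: des_transpose_top[OF \<tau>] sign_transpose_top[OF \<tau>(1)])
  qed
  then show ?thesis by (simp add: sum_negf)
qed

text \<open>Moving a block of two letters past others does not change the sign. The ascending block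
  (\<open>q = p + 1\<close>) thus keeps the sign of \<open>\<sigma>\<close> and the descents of the
  one-letter insertion; the descending one (\<open>q = p\<close>) flips the sign and adds a
  descent.\<close>

lemma sum_top_adjacent_insert_max:
  fixes f :: "nat \<Rightarrow> int"
  assumes \<sigma>: "\<sigma> permutes {1..n}" and p: "p \<in> {1..Suc n}"
  shows "(\<Sum>q\<in>{1..Suc (Suc n)}. let \<tau> = insert_max (Suc n) q (insert_max n p \<sigma>) in
      if top_adjacent n \<tau> then sign \<tau> * f (des (Suc (Suc n)) \<tau>) else 0) =
    sign \<sigma> * (f (des (Suc n) (insert_max n p \<sigma>)) - f (Suc (des (Suc n) (insert_max n p \<sigma>))))"
proof -
  define \<pi> where "\<pi> = insert_max n p \<sigma>"
  define g where "g q = sign (insert_max (Suc n) q \<pi>) * f (des (Suc (Suc n)) (insert_max (Suc n) q \<pi>))" for q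
  have \<pi>: "\<pi> permutes {1..Suc n}" unfolding \<pi>_def by (rule insert_max_permutes[OF \<sigma> p])
  have des: "descents (Suc n) \<pi> = {i \<in> descents n \<sigma>. Suc i < p} \<union> (if p \<le> n then {p} else {}) \<union> Suc ` {i \<in> descents n \<sigma>. p \<le> i}"
    unfolding \<pi>_def by (rule descents_insert_max[OF \<sigma> p])
  have sg: "sign \<pi> = (-1) ^ (Suc n - p) * sign \<sigma>"
    unfolding \<pi>_def by (rule sign_insert_max[OF \<sigma> p])
  have "(\<Sum>q\<in>{1..Suc (Suc n)}. let \<tau> = insert_max (Suc n) q \<pi> in
      if top_adjacent n \<tau> then sign \<tau> * f (des (Suc (Suc n)) \<tau>) else 0) =
    (\<Sum>q\<in>{1..Suc (Suc n)}. if q \<in> {p, Suc p} then g q else 0)"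
    unfolding \<pi>_def g_def using top_adjacent_insert_max[OF \<sigma> p]
    by (intro sum.cong refl) (simp add: Let_def)
  also have "\<dots> = g p + g (Suc p)"
    using p by (subst sum.inter_restrict[symmetric]) (auto simp: Int_absorb1)
  also have "g p = - sign \<sigma> * f (Suc (des (Suc n) \<pi>))"
  proof -
    have "p - 1 \<notin> descents (Suc n) \<pi>" using p by (auto simp: des)
    then have "des (Suc (Suc n)) (insert_max (Suc n) p \<pi>) = Suc (des (Suc n) \<pi>)"
      using p by (subst des_insert_max[OF \<pi>]) auto
    moreover have "sign (insert_max (Suc n) p \<pi>) = - sign \<sigma>"
      using p by (subst sign_insert_max[OF \<pi>]) (auto simp: sg Suc_diff_le)
    ultimately show ?thesis by (simp add: g_def)
  qed
  also have "g (Suc p) = sign \<sigma> * f (des (Suc n) \<pi>)"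
  proof -
    have "Suc p = Suc (Suc n) \<or> p \<in> descents (Suc n) \<pi>" using p by (auto simp: des)
    then have "des (Suc (Suc n)) (insert_max (Suc n) (Suc p) \<pi>) = des (Suc n) \<pi>"
      using p by (subst des_insert_max[OF \<pi>]) auto
    moreover have "sign (insert_max (Suc n) (Suc p) \<pi>) = sign \<sigma>"
      using p by (subst sign_insert_max[OF \<pi>]) (auto simp: sg)
    ultimately show ?thesis by (simp add: g_def)
  qed
  finally show ?thesis unfolding \<pi>_def by (simp add: algebra_simps)
qed

lemma sum_sign_des_Suc_Suc:
  fixes f :: "nat \<Rightarrow> int"
  shows "(\<Sum>\<tau>\<in>perms (Suc (Suc n)). sign \<tau> * f (des (Suc (Suc n)) \<tau>)) =
    (\<Sum>\<sigma>\<in>perms n. sign \<sigma> * ((int (des n \<sigma>) + 1) * (f (des n \<sigma>) - f (Suc (des n \<sigma>)))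
      + (int n - int (des n \<sigma>)) * (f (Suc (des n \<sigma>)) - f (Suc (Suc (des n \<sigma>))))))"
proof -
  let ?g = "\<lambda>\<tau>. sign \<tau> * f (des (Suc (Suc n)) \<tau>)"
  have "(\<Sum>\<tau>\<in>perms (Suc (Suc n)). ?g \<tau>) =
      (\<Sum>\<tau>\<in>{\<tau> \<in> perms (Suc (Suc n)). top_adjacent n \<tau>}. ?g \<tau>)
      + (\<Sum>\<tau>\<in>{\<tau> \<in> perms (Suc (Suc n)). \<not> top_adjacent n \<tau>}. ?g \<tau>)"
    by (subst sum.union_disjoint[symmetric]) (auto simp: finite_permutations intro!: sum.cong)
  also have "\<dots> = (\<Sum>\<tau>\<in>{\<tau> \<in> perms (Suc (Suc n)). top_adjacent n \<tau>}. ?g \<tau>)"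
    by (simp only: sum_not_top_adjacent)
  also have "\<dots> = (\<Sum>\<tau>\<in>perms (Suc (Suc n)). if top_adjacent n \<tau> then ?g \<tau> else 0)"
    by (subst sum.inter_filter) (auto simp: finite_permutations)
  also have "\<dots> = (\<Sum>\<sigma>\<in>perms n. \<Sum>p\<in>{1..Suc n}. sign \<sigma> *
      (f (des (Suc n) (insert_max n p \<sigma>)) - f (Suc (des (Suc n) (insert_max n p \<sigma>)))))"
    unfolding sum_perms_Suc[of _ "Suc n"] sum_perms_Suc[of _ n]
    using sum_top_adjacent_insert_max[of _ n _ f] by (intro sum.cong refl) (auto simp: Let_def)
  also have "\<dots> = (\<Sum>\<sigma>\<in>perms n. sign \<sigma> * ((int (des n \<sigma>) + 1) * (f (des n \<sigma>) - f (Suc (des n \<sigma>)))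
      + (int n - int (des n \<sigma>)) * (f (Suc (des n \<sigma>)) - f (Suc (Suc (des n \<sigma>))))))"
    \<comment> \<open>The difference \<open>f d - f (Suc d)\<close> encodes the factor
      \<open>1 - t\<close>; summing it over \<open>p\<close> gives one Eulerian step.\<close>
    using sum_des_insert_max[of _ n "\<lambda>d. f d - f (Suc d)"]
    by (intro sum.cong refl) (auto simp: simp flip: sum_distrib_left)
  finally show ?thesis .
qed

lemma sum_sign_des: "(\<Sum>\<pi>\<in>perms n. sign \<pi> * of_bool (des n \<pi> = k)) = signed_eulerian n k"
proof (induction n k rule: signed_eulerian.induct)
  case (1 k)
  then show ?case by (simp add: des_def sign_id)
next
  case (2 k)
  then show ?case by (simp add: des_def sign_id)
next
  case (3 n k)
  have IH: "(\<lambda>j. \<Sum>\<pi>\<in>perms n. sign \<pi> * of_bool (des n \<pi> = j)) = signed_eulerian n"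
    using 3 by auto
  let ?h = "\<lambda>k \<sigma>. sign \<sigma> * ((int (des n \<sigma>) + 1) * of_bool (des n \<sigma> = k)
      + (int n - int (des n \<sigma>)) * of_bool (Suc (des n \<sigma>) = k))"
  have h: "sum (?h j) (perms n) = eulerian_step n (signed_eulerian n) j" for j
    unfolding sum_indicator_step IH ..
  have "(\<Sum>\<pi>\<in>perms (Suc (Suc n)). sign \<pi> * of_bool (des (Suc (Suc n)) \<pi> = k)) =
     (\<Sum>\<sigma>\<in>perms n. ?h k \<sigma> - (if k = 0 then 0 else ?h (k - 1) \<sigma>))"
    unfolding sum_sign_des_Suc_Suc[of "\<lambda>d. of_bool (d = k)" n]
    by (intro sum.cong refl) (cases k; simp add: algebra_simps)
  also have "\<dots> = signed_eulerian (Suc (Suc n)) k"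
    unfolding sum_subtractf h by (cases "k = 0") (simp_all only: h signed_eulerian.simps if_True if_False sum.neutral_const refl)
  finally show ?case .
qed

section \<open>Excedances\<close>

lemma Suc_times_choose_Suc: "Suc k * (n choose Suc k) = (n - k) * (n choose k)"
  by (metis binomial_absorb_comp binomial_absorption)

section \<open>Excedances when a largest element is inserted into a cycle\<close>

lemma exc_le: "exc n \<pi> \<le> n"
proof -
  have "card {i \<in> {1..n}. \<pi> i > i} \<le> card {1..n}" by (rule card_mono) auto
  then show ?thesis by (simp add: exc_def)
qed

lemma exc_Suc:
  assumes "\<pi> permutes {1..n}"
  shows "exc (Suc n) \<pi> = exc n \<pi>"
proof -
  have "{i \<in> {1..Suc n}. \<pi> i > i} = {i \<in> {1..n}. \<pi> i > i}"
    using permutes_gt[OF assms, of "Suc n"] by (auto simp: le_Suc_eq)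
  then show ?thesis by (simp add: exc_def)
qed

text \<open>In cycle notation \<open>n + 1\<close> is inserted right after \<open>i\<close>. Now
  \<open>i\<close> is mapped to \<open>n + 1\<close> and is an excedance, \<open>n + 1\<close> is
  not one, and all other points keep their images.\<close>

lemma exc_transpose_max:
  assumes \<pi>: "\<pi> permutes {1..n}" and i: "i \<in> {1..n}"
  shows "exc (Suc n) (transpose (Suc n) (\<pi> i) \<circ> \<pi>) = exc n \<pi> + of_bool (\<not> \<pi> i > i)"
proof -
  let ?E = "{j \<in> {1..n}. \<pi> j > j}"
  have "\<pi> i \<le> n" using permutes_le[OF \<pi>] i by auto
  have "(transpose (Suc n) (\<pi> i) \<circ> \<pi>) j = (if j = i then Suc n else if j = Suc n then \<pi> i else \<pi> j)" for j
    using permutes_gt[OF \<pi>, of "Suc n"] permutes_inj[OF \<pi>]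
    by (auto simp: transpose_def inj_eq) (metis inj_eq)
  then have "{j \<in> {1..Suc n}. (transpose (Suc n) (\<pi> i) \<circ> \<pi>) j > j} = insert i ?E"
    using i \<open>\<pi> i \<le> n\<close> by (auto simp: le_Suc_eq)
  then have "exc (Suc n) (transpose (Suc n) (\<pi> i) \<circ> \<pi>) = card (insert i ?E)"
    by (simp add: exc_def)
  also have "\<dots> = card ?E + of_bool (\<not> \<pi> i > i)"
    using i by (subst card_insert_if) auto
  finally show ?thesis by (simp add: exc_def)
qed

text \<open>The factor \<open>s\<close> records how the weight reacts to a transposition:
  \<open>s = 1\<close> for constant weight, \<open>s = -1\<close> for the sign. The summand without
  \<open>s\<close> comes from \<open>n + 1\<close> as a fixed point.\<close>

lemma sum_exc_Suc:
  fixes f :: "nat \<Rightarrow> int" and c :: "(nat \<Rightarrow> nat) \<Rightarrow> int"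
  assumes c: "\<And>\<pi> b. \<pi> permutes {1..n} \<Longrightarrow> b \<in> {1..n} \<Longrightarrow> c (transpose (Suc n) b \<circ> \<pi>) = s * c \<pi>"
  shows "(\<Sum>\<tau>\<in>perms (Suc n). c \<tau> * f (exc (Suc n) \<tau>)) =
    (\<Sum>\<pi>\<in>perms n. c \<pi> * ((1 + s * int (exc n \<pi>)) * f (exc n \<pi>)
      + s * (int n - int (exc n \<pi>)) * f (Suc (exc n \<pi>))))"
proof -
  let ?g = "\<lambda>\<tau>. c \<tau> * f (exc (Suc n) \<tau>)"
  have ins: "{1..Suc n} = insert (Suc n) {1..n}" by auto
  have "(\<Sum>\<tau>\<in>perms (Suc n). ?g \<tau>) =
      (\<Sum>b\<in>insert (Suc n) {1..n}. \<Sum>\<pi>\<in>perms n. ?g (transpose (Suc n) b \<circ> \<pi>))"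
    unfolding ins by (rule sum_over_permutations_insert) auto
  also have "\<dots> = (\<Sum>\<pi>\<in>perms n. ?g \<pi> + (\<Sum>b\<in>{1..n}. ?g (transpose (Suc n) b \<circ> \<pi>)))"
    unfolding sum.swap[of _ "perms n"] by (intro sum.cong refl) simp
  also have "\<dots> = (\<Sum>\<pi>\<in>perms n. c \<pi> * ((1 + s * int (exc n \<pi>)) * f (exc n \<pi>)
      + s * (int n - int (exc n \<pi>)) * f (Suc (exc n \<pi>))))"
  proof (intro sum.cong refl)
    fix \<pi> assume "\<pi> \<in> perms n"
    then have \<pi>: "\<pi> permutes {1..n}" by simp
    let ?E = "{i. \<pi> i > i}"
    have "card ({1..n} \<inter> ?E) = exc n \<pi>" by (simp add: exc_def Int_def)
    moreover have "card ({1..n} \<inter> - ?E) = n - exc n \<pi>"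
    proof -
      have "{1..n} \<inter> - ?E = {1..n} - {1..n} \<inter> ?E" by auto
      then show ?thesis using calculation by (simp add: card_Diff_subset)
    qed
    ultimately have cards: "int (card ({1..n} \<inter> ?E)) = int (exc n \<pi>)"
      "int (card ({1..n} \<inter> - ?E)) = int n - int (exc n \<pi>)"
      using exc_le[of n \<pi>] by auto
    \<comment> \<open>Reindexing by \<open>b = \<pi> i\<close> makes \<open>i\<close> the
      predecessor of the inserted element, so the effect depends only on whether \<open>i\<close> is
      an excedance.\<close>
    have "(\<Sum>b\<in>{1..n}. ?g (transpose (Suc n) b \<circ> \<pi>)) =
        (\<Sum>i\<in>{1..n}. ?g (transpose (Suc n) (\<pi> i) \<circ> \<pi>))"
      using sum.permute[OF \<pi>] by (simp add: o_def)
    also have "\<dots> = (\<Sum>i\<in>{1..n}. s * c \<pi> * (if \<pi> i > i then f (exc n \<pi>) else f (Suc (exc n \<pi>))))"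
    proof (intro sum.cong refl)
      fix i assume i: "i \<in> {1..n}"
      then have "\<pi> i \<in> {1..n}" using permutes_in_image[OF \<pi>] by blast
      then show "?g (transpose (Suc n) (\<pi> i) \<circ> \<pi>) =
        s * c \<pi> * (if \<pi> i > i then f (exc n \<pi>) else f (Suc (exc n \<pi>)))"
        by (simp only: c[OF \<pi>] exc_transpose_max[OF \<pi> i]) simp
    qed
    also have "\<dots> = s * c \<pi> * (int (exc n \<pi>) * f (exc n \<pi>) + (int n - int (exc n \<pi>)) * f (Suc (exc n \<pi>)))"
      by (simp only: sum.If_cases finite_atLeastAtMost sum_constant cards flip: sum_distrib_left)
    finally show "?g \<pi> + (\<Sum>b\<in>{1..n}. ?g (transpose (Suc n) b \<circ> \<pi>)) =
      c \<pi> * ((1 + s * int (exc n \<pi>)) * f (exc n \<pi>) + s * (int n - int (exc n \<pi>)) * f (Suc (exc n \<pi>)))"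
      by (simp only: exc_Suc[OF \<pi>]) (simp only: algebra_simps)
  qed
  finally show ?thesis .
qed

lemma sum_exc_eulerian: "(\<Sum>\<pi>\<in>perms n. 1 * of_bool (exc n \<pi> = k)) = eulerian n k"
proof (induction n arbitrary: k)
  case 0
  then show ?case by (simp add: exc_def)
next
  case (Suc n)
  have "(\<Sum>\<pi>\<in>perms (Suc n). 1 * of_bool (exc (Suc n) \<pi> = k) :: int) = (\<Sum>\<pi>\<in>perms n.
    1 * ((int (exc n \<pi>) + 1) * of_bool (exc n \<pi> = k) + (int n - int (exc n \<pi>)) * of_bool (Suc (exc n \<pi>) = k)))"
    by (subst sum_exc_Suc[where s = 1 and c = "\<lambda>_. 1"]) (simp_all only: mult_1 add.commute)
  also have "\<dots> = eulerian_step n (eulerian n) k"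
    unfolding sum_indicator_step Suc ..
  finally show ?case by simp
qed

text \<open>For \<open>s = -1\<close> and \<open>N = n + 1\<close> the recurrence is
  \<open>a(t) -> (1 - N t) a(t) - t (1 - t) a'(t)\<close>, which multiplies \<open>(1 - t)^n\<close>
  by \<open>1 - t\<close>.\<close>

lemma sum_sign_exc:
  "(\<Sum>\<pi>\<in>perms (Suc n). sign \<pi> * of_bool (exc (Suc n) \<pi> = k)) = (-1) ^ k * int (n choose k)"
proof (induction n arbitrary: k)
  case 0
  show ?case by (cases k) (simp_all add: exc_def sign_id)
next
  case (Suc n)
  let ?N = "Suc n"
  have "sign (transpose (Suc ?N) b \<circ> \<pi>) = -1 * sign \<pi>"
    if "\<pi> permutes {1..?N}" "b \<in> {1..?N}" for \<pi> b
    using permutes_imp_permutation[OF _ that(1)] that(2)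
    by (auto simp: sign_compose permutation_swap_id sign_swap_id)
  note step = sum_exc_Suc[OF this, where f = "\<lambda>e. of_bool (e = k)"]
  have "(\<Sum>\<pi>\<in>perms (Suc ?N). sign \<pi> * of_bool (exc (Suc ?N) \<pi> = k)) =
    (\<Sum>\<pi>\<in>perms ?N. (1 - int k) * (sign \<pi> * of_bool (exc ?N \<pi> = k))
      - (if k = 0 then 0 else (int ?N + 1 - int k) * (sign \<pi> * of_bool (exc ?N \<pi> = k - 1))))"
    by (subst step, assumption, assumption, intro sum.cong refl)
       (cases k; auto simp: algebra_simps)
  also have "\<dots> = (1 - int k) * ((-1) ^ k * int (n choose k))
      - (if k = 0 then 0 else (int ?N + 1 - int k) * ((-1) ^ (k - 1) * int (n choose (k - 1))))"
    unfolding sum_subtractf Suc[symmetric] sum_distrib_left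
    by (cases "k = 0") (simp_all only: if_True if_False sum.neutral_const refl)
  also have "\<dots> = (-1) ^ k * int (?N choose k)"
  proof (cases k)
    case (Suc j)
    \<comment> \<open>The absorption identity over the integers; for \<open>j > n\<close> both
      binomials vanish, which covers the truncated subtraction.\<close>
    have "int (Suc j) * int (n choose Suc j) = (int n - int j) * int (n choose j)"
    proof (cases "j \<le> n")
      case True
      have "int (Suc j * (n choose Suc j)) = int ((n - j) * (n choose j))"
        by (simp only: Suc_times_choose_Suc)
      then show ?thesis using True by (simp only: of_nat_mult of_nat_diff)
    qed (simp add: binomial_eq_0)
    then have "(1 - int (Suc j)) * int (n choose Suc j) + (int n + 1 - int j) * int (n choose j)
      = int (n choose Suc j) + int (n choose j)" by (simp add: algebra_simps)
    then have "- ((-1) ^ j) * ((1 - int (Suc j)) * int (n choose Suc j)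
        + (int n + 1 - int j) * int (n choose j))
      = - ((-1) ^ j) * (int (n choose Suc j) + int (n choose j))" by (simp only:)
    then show ?thesis by (simp add: Suc algebra_simps)
  qed simp
  finally show ?case .
qed

section \<open>Even and odd counts as half sums and half differences of plain and signed
  counts\<close>

lemma even_odd_counts:
  assumes "finite S"
  shows "2 * int (card {\<pi> \<in> S. evenperm \<pi>}) = (\<Sum>\<pi>\<in>S. 1) + (\<Sum>\<pi>\<in>S. sign \<pi>)"
    and "2 * int (card {\<pi> \<in> S. \<not> evenperm \<pi>}) = (\<Sum>\<pi>\<in>S. 1) - (\<Sum>\<pi>\<in>S. sign \<pi>)"
proof -
  have "S = {\<pi> \<in> S. evenperm \<pi>} \<union> {\<pi> \<in> S. \<not> evenperm \<pi>}" by auto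
  then have "sum g S = sum g {\<pi> \<in> S. evenperm \<pi>} + sum g {\<pi> \<in> S. \<not> evenperm \<pi>}" for g :: "_ \<Rightarrow> int"
    using assms by (subst sum.union_disjoint[symmetric]) auto
  note split = this
  have "(\<Sum>\<pi>\<in>S. sign \<pi>) = int (card {\<pi> \<in> S. evenperm \<pi>}) - int (card {\<pi> \<in> S. \<not> evenperm \<pi>})"
    unfolding split by (simp add: sign_def)
  moreover have "(\<Sum>\<pi>\<in>S. 1) = int (card {\<pi> \<in> S. evenperm \<pi>}) + int (card {\<pi> \<in> S. \<not> evenperm \<pi>})"
    unfolding split by simp
  ultimately show "2 * int (card {\<pi> \<in> S. evenperm \<pi>}) = (\<Sum>\<pi>\<in>S. 1) + (\<Sum>\<pi>\<in>S. sign \<pi>)"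
    and "2 * int (card {\<pi> \<in> S. \<not> evenperm \<pi>}) = (\<Sum>\<pi>\<in>S. 1) - (\<Sum>\<pi>\<in>S. sign \<pi>)" by simp_all
qed

lemma even_odd_counts_statistic:
  fixes st :: "(nat \<Rightarrow> nat) \<Rightarrow> nat"
  shows "2 * int (card {\<pi>. \<pi> permutes {1..n} \<and> evenperm \<pi> \<and> st \<pi> = k}) =
      (\<Sum>\<pi>\<in>perms n. 1 * of_bool (st \<pi> = k)) + (\<Sum>\<pi>\<in>perms n. sign \<pi> * of_bool (st \<pi> = k))"
    and "2 * int (card {\<pi>. \<pi> permutes {1..n} \<and> \<not> evenperm \<pi> \<and> st \<pi> = k}) =
      (\<Sum>\<pi>\<in>perms n. 1 * of_bool (st \<pi> = k)) - (\<Sum>\<pi>\<in>perms n. sign \<pi> * of_bool (st \<pi> = k))"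
proof -
  let ?S = "{\<pi> \<in> perms n. st \<pi> = k}"
  have fin: "finite ?S" by (simp add: finite_permutations)
  have "(\<Sum>\<pi>\<in>perms n. g \<pi> * of_bool (st \<pi> = k)) = sum g ?S" for g :: "_ \<Rightarrow> int"
    by (subst sum.inter_filter, simp add: finite_permutations, intro sum.cong) auto
  note flt = this
  have "{\<pi>. \<pi> permutes {1..n} \<and> evenperm \<pi> \<and> st \<pi> = k} = {\<pi> \<in> ?S. evenperm \<pi>}"
    "{\<pi>. \<pi> permutes {1..n} \<and> \<not> evenperm \<pi> \<and> st \<pi> = k} = {\<pi> \<in> ?S. \<not> evenperm \<pi>}" by auto
  then show "2 * int (card {\<pi>. \<pi> permutes {1..n} \<and> evenperm \<pi> \<and> st \<pi> = k}) =
      (\<Sum>\<pi>\<in>perms n. 1 * of_bool (st \<pi> = k)) + (\<Sum>\<pi>\<in>perms n. sign \<pi> * of_bool (st \<pi> = k))"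
    and "2 * int (card {\<pi>. \<pi> permutes {1..n} \<and> \<not> evenperm \<pi> \<and> st \<pi> = k}) =
      (\<Sum>\<pi>\<in>perms n. 1 * of_bool (st \<pi> = k)) - (\<Sum>\<pi>\<in>perms n. sign \<pi> * of_bool (st \<pi> = k))"
    unfolding flt using even_odd_counts[OF fin] by simp_all
qed

lemma B_num_eq: "2 * int (B_num n k) = eulerian n k + signed_eulerian n k"
  unfolding B_num_def even_odd_counts_statistic sum_des_eulerian sum_sign_des ..

lemma C_num_eq: "2 * int (C_num n k) = eulerian n k - signed_eulerian n k"
  unfolding C_num_def even_odd_counts_statistic sum_des_eulerian sum_sign_des ..

lemma P_num_eq: "2 * int (P_num (Suc n) k) = eulerian (Suc n) k + (-1) ^ k * int (n choose k)"
  unfolding P_num_def even_odd_counts_statistic sum_exc_eulerian sum_sign_exc ..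

lemma Q_num_eq: "2 * int (Q_num (Suc n) k) = eulerian (Suc n) k - (-1) ^ k * int (n choose k)"
  unfolding Q_num_def even_odd_counts_statistic sum_exc_eulerian sum_sign_exc ..

section \<open>Strong log-concavity of the Eulerian numbers\<close>

lemma eulerian_0 [simp]: "eulerian n 0 = 1"
  by (induction n) (auto simp: eulerian_step_def)

lemma eulerian_eq_0: "n \<le> k \<Longrightarrow> 0 < k \<Longrightarrow> eulerian n k = 0"
proof (induction n arbitrary: k)
  case (Suc n)
  have "k = Suc n \<or> eulerian n (k - 1) = 0"
    using Suc by (cases "k = Suc n") auto
  moreover have "eulerian n k = 0" using Suc by simp
  ultimately show ?case by (auto simp: eulerian_step_def)
qed simp

lemma eulerian_Suc_Suc:
  "eulerian (Suc n) (Suc k) = (int k + 2) * eulerian n (Suc k) + (int n - int k) * eulerian n k"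
  by (simp add: eulerian_step_def)

declare eulerian.simps(2) [simp del]

lemma eulerian_last: "eulerian (Suc n) n = 1"
proof (induction n)
  case (Suc n)
  then show ?case by (simp add: eulerian_Suc_Suc eulerian_eq_0)
qed simp

lemma eulerian_pos: "k < n \<Longrightarrow> 0 < eulerian n k"
proof (induction n arbitrary: k)
  case (Suc n)
  show ?case
  proof (cases k)
    case [simp]: (Suc j)
    have "0 < (int n - int j) * eulerian n j"
      using Suc.prems Suc.IH[of j] by simp
    moreover have "0 \<le> eulerian n (Suc j)"
      using Suc.IH[of "Suc j"] eulerian_eq_0[of n "Suc j"] by (cases "Suc j < n") auto
    ultimately show ?thesis
      by (simp add: eulerian_Suc_Suc add_nonneg_pos)
  qed simp
qed simp

lemma eulerian_nonneg: "0 \<le> eulerian n k"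
  using eulerian_pos[of k n] eulerian_eq_0[of n k] eulerian_0[of n]
  by (cases "k < n"; cases "k = 0") auto

lemma eulerian_symmetric: "i + j = n \<Longrightarrow> eulerian (Suc n) i = eulerian (Suc n) j"
proof (induction n arbitrary: i j)
  case (Suc n)
  show ?case
  proof (cases "i = 0 \<or> j = 0")
    case True
    with Suc.prems show ?thesis using eulerian_last[of "Suc n"] by (auto)
  next
    case False
    then obtain a b where ab: "i = Suc a" "j = Suc b" by (meson not0_implies_Suc)
    have "eulerian (Suc n) (Suc a) = eulerian (Suc n) b" "eulerian (Suc n) a = eulerian (Suc n) (Suc b)"
      using Suc.prems ab by (intro Suc.IH; simp)+
    moreover have "int n = int a + int b + 1" using Suc.prems ab by simp
    ultimately show ?thesis
      by (simp add: ab eulerian_Suc_Suc[of "Suc n"] algebra_simps)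
  qed
qed auto

text \<open>Serves the mixed term in \<open>log_concave_step\<close>. With
  \<open>u = x^2 + x\<close>, \<open>v = y^2 + y\<close> and the two factors in \<open>m\<close>
  equal to \<open>P\<close> and \<open>P - 4\<close>, the claim is
  \<open>4 u v \<le> 2 P (u + v - 2)\<close>. It follows from \<open>4 u v \<le> (u + v)^2\<close>,
  \<open>u + v \<le> P\<close> and \<open>u + v \<ge> 4\<close>.\<close>

lemma log_concave_coeff:
  fixes x y :: real
  assumes "x \<ge> 1" "y \<ge> 1" "x + y \<ge> 3"
  defines "m \<equiv> x + y"
  shows "(m + 2) * (m - 1)\<^sup>2 * ((x\<^sup>2 + x - 2) * (y\<^sup>2 + y - 2))
    \<le> (m + 1)\<^sup>2 * (m - 2) * ((x\<^sup>2 + x) * (y\<^sup>2 + y))"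
proof -
  define u v where "u = x\<^sup>2 + x" and "v = y\<^sup>2 + y"
  define P where "P = (m + 2) * (m - 1)\<^sup>2"
  have P': "(m + 1)\<^sup>2 * (m - 2) = P - 4"
    by (simp add: P_def power2_eq_square algebra_simps)
  have u: "u \<ge> 2" and v: "v \<ge> 2"
    using assms(1,2) one_le_power[of x 2] one_le_power[of y 2] unfolding u_def v_def by linarith+
  have "u + v \<le> m\<^sup>2 + m"
    using assms by (simp add: u_def v_def m_def power2_eq_square algebra_simps)
  also have "\<dots> \<le> P"
  proof -
    \<comment> \<open>The Taylor expansion of \<open>P - (m^2 + m)\<close> at \<open>m = 3\<close>
      has only nonnegative coefficients.\<close>
    have "0 \<le> (m - 3) ^ 3 + 8 * (m - 3)\<^sup>2 + 17 * (m - 3) + 8"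
      using assms(3) by (intro add_nonneg_nonneg) (auto simp: m_def)
    also have "\<dots> = P - (m\<^sup>2 + m) "
      by (simp add: P_def power2_eq_square power3_eq_cube algebra_simps)
    finally show ?thesis by simp
  qed
  finally have uvP: "u + v \<le> P" .
  have "4 * (u * v) \<le> (u + v) * (u + v)"
    using zero_le_power2[of "u - v"] by (simp add: power2_eq_square algebra_simps)
  also have "\<dots> \<le> P * (2 * (u + v - 2))"
    using uvP u v by (intro mult_mono) auto
  finally have "P * ((u - 2) * (v - 2)) \<le> (P - 4) * (u * v)"
    by (simp add: algebra_simps)
  then show ?thesis by (simp only: P' flip: u_def v_def P_def)
qed

text \<open>Here \<open>a, b, c, d\<close> are the entries at \<open>i - 2, ..., i + 1\<close> of
  one row, with \<open>x = i\<close> and \<open>y = j\<close>; the recurrence forms three entries of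
  the next row from them. After expansion the terms in \<open>b d\<close>, in \<open>a c\<close>,
  and in \<open>b c\<close> and \<open>a d\<close> together are dominated by the \<open>c^2\<close>,
  \<open>b^2\<close> and \<open>b c\<close> parts of the square.\<close>

lemma log_concave_step:
  fixes a b c d x y :: real
  assumes x: "x \<ge> 1" and y: "y \<ge> 1" and xy: "x + y \<ge> 3"
    and nn: "a \<ge> 0" "b > 0" "c > 0" "d \<ge> 0"
  defines "m \<equiv> x + y"
  assumes H1: "(x + 1) * y * (m + 1) * (b * d) \<le> x * (y - 1) * (m - 1) * c\<^sup>2"
    and H2: "x * (y + 1) * (m + 1) * (a * c) \<le> (x - 1) * y * (m - 1) * b\<^sup>2"
  shows "(x + 1) * (y + 1) * (m + 2) * ((x * b + (y + 2) * a) * ((x + 2) * d + y * c))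
    \<le> x * y * m * ((x + 1) * c + (y + 1) * b)\<^sup>2"
proof -
  have m: "m \<ge> 3" using xy by (simp add: m_def)
  have bd: "b * d \<le> x * (y - 1) * (m - 1) / ((x + 1) * y * (m + 1)) * c\<^sup>2"
  proof -
    have "0 < (x + 1) * y * (m + 1)" using x y m by simp
    with H1 show ?thesis by (simp add: pos_le_divide_eq mult_ac)
  qed
  have ac: "a * c \<le> (x - 1) * y * (m - 1) / (x * (y + 1) * (m + 1)) * b\<^sup>2"
  proof -
    have "0 < x * (y + 1) * (m + 1)" using x y m by simp
    with H2 show ?thesis by (simp add: pos_le_divide_eq mult_ac)
  qed
  \<comment> \<open>Multiplying both hypotheses and cancelling the positive \<open>b c\<close>
    bounds the outer product \<open>a d\<close> by \<open>b c\<close>.\<close>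
  have "(b * d) * (a * c) \<le> (x * (y - 1) * (m - 1) / ((x + 1) * y * (m + 1)) * c\<^sup>2) *
      ((x - 1) * y * (m - 1) / (x * (y + 1) * (m + 1)) * b\<^sup>2)"
    using nn x y m by (intro mult_mono[OF bd ac]) auto
  also have "\<dots> = ((x - 1) * (y - 1) * (m - 1)\<^sup>2 / ((x + 1) * (y + 1) * (m + 1)\<^sup>2) * (b * c)) * (b * c)"
    using x y m by (simp add: divide_simps) (simp add: power2_eq_square)
  finally have "(a * d) * (b * c) \<le>
      ((x - 1) * (y - 1) * (m - 1)\<^sup>2 / ((x + 1) * (y + 1) * (m + 1)\<^sup>2) * (b * c)) * (b * c)"
    by (simp add: mult_ac)
  then have ad: "a * d \<le> (x - 1) * (y - 1) * (m - 1)\<^sup>2 / ((x + 1) * (y + 1) * (m + 1)\<^sup>2) * (b * c)"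
    using nn by (simp only: mult_le_cancel_right_pos mult_pos_pos)

  have le1: "t * (t + 2) \<le> (t + 1)\<^sup>2" and le2: "(t + 1) * (t - 1) \<le> t\<^sup>2" for t :: real
    by (simp_all add: power2_eq_square algebra_simps)
  have le3: "(m + 2) * (m - 1) \<le> m * (m + 1)" by (simp add: algebra_simps)
  have cc: "(x + 1) * (y + 1) * (m + 2) * (x * (x + 2) * (b * d)) \<le> x * y * m * ((x + 1)\<^sup>2 * c\<^sup>2)"
  proof -
    have "(y * (m + 1)) * ((x + 1) * (y + 1) * (m + 2) * (x * (x + 2) * (b * d))) = (x * (x + 2) * (y + 1) * (m + 2)) * ((x + 1) * y * (m + 1) * (b * d))"
      by (simp only: mult_ac)
    also have "\<dots> \<le> (x * (x + 2) * (y + 1) * (m + 2)) * (x * (y - 1) * (m - 1) * c\<^sup>2)"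
      using H1 x y m by (intro mult_left_mono) auto
    also have "\<dots> = x * c\<^sup>2 * ((x * (x + 2)) * ((y + 1) * (y - 1)) * ((m + 2) * (m - 1)))"
      by (simp only: mult_ac)
    also have "\<dots> \<le> x * c\<^sup>2 * ((x + 1)\<^sup>2 * y\<^sup>2 * (m * (m + 1)))"
      using x y m by (intro mult_left_mono mult_mono[OF mult_mono[OF le1[of x] le2[of y]] le3]) auto
    also have "\<dots> = (y * (m + 1)) * (x * y * m * ((x + 1)\<^sup>2 * c\<^sup>2))"
      by (simp only: power2_eq_square mult_ac)
    finally show ?thesis using mult_pos_pos[of y "m + 1"] y m by (subst (asm) mult_le_cancel_left_pos) auto
  qed
  have bb: "(x + 1) * (y + 1) * (m + 2) * (y * (y + 2) * (a * c)) \<le> x * y * m * ((y + 1)\<^sup>2 * b\<^sup>2)"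
  proof -
    have "(x * (m + 1)) * ((x + 1) * (y + 1) * (m + 2) * (y * (y + 2) * (a * c))) = (y * (y + 2) * (x + 1) * (m + 2)) * (x * (y + 1) * (m + 1) * (a * c))"
      by (simp only: mult_ac)
    also have "\<dots> \<le> (y * (y + 2) * (x + 1) * (m + 2)) * ((x - 1) * y * (m - 1) * b\<^sup>2)"
      using H2 x y m by (intro mult_left_mono) auto
    also have "\<dots> = y * b\<^sup>2 * ((y * (y + 2)) * ((x + 1) * (x - 1)) * ((m + 2) * (m - 1)))"
      by (simp only: mult_ac)
    also have "\<dots> \<le> y * b\<^sup>2 * ((y + 1)\<^sup>2 * x\<^sup>2 * (m * (m + 1)))"
      using x y m by (intro mult_left_mono mult_mono[OF mult_mono[OF le1[of y] le2[of x]] le3]) auto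
    also have "\<dots> = (x * (m + 1)) * (x * y * m * ((y + 1)\<^sup>2 * b\<^sup>2))"
      by (simp only: power2_eq_square mult_ac)
    finally show ?thesis using mult_pos_pos[of x "m + 1"] x m by (subst (asm) mult_le_cancel_left_pos) auto
  qed
  have bc: "(x + 1) * (y + 1) * (m + 2) * (x * y * (b * c) + (x + 2) * (y + 2) * (a * d))
    \<le> x * y * m * (2 * (x + 1) * (y + 1) * (b * c))"
  proof -
    have "(x + 1) * (y + 1) * (m + 2) * ((x + 2) * (y + 2) * (a * d)) \<le>
      (x + 1) * (y + 1) * (m + 2) * ((x + 2) * (y + 2) *
        ((x - 1) * (y - 1) * (m - 1)\<^sup>2 / ((x + 1) * (y + 1) * (m + 1)\<^sup>2) * (b * c)))"
      using ad x y m by (intro mult_left_mono) auto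
    also have "\<dots> = (m + 2) * (m - 1)\<^sup>2 * ((x\<^sup>2 + x - 2) * (y\<^sup>2 + y - 2)) / (m + 1)\<^sup>2 * (b * c)"
    proof -
      have "x\<^sup>2 + x - 2 = (x + 2) * (x - 1)" "y\<^sup>2 + y - 2 = (y + 2) * (y - 1)"
        by (simp_all add: power2_eq_square algebra_simps)
      then show ?thesis using x y m by (simp add: divide_simps)
    qed
    also have "\<dots> \<le> (m + 1)\<^sup>2 * (m - 2) * ((x\<^sup>2 + x) * (y\<^sup>2 + y)) / (m + 1)\<^sup>2 * (b * c)"
      using log_concave_coeff[OF x y xy] nn
      by (intro mult_right_mono divide_right_mono) (auto simp: m_def)
    also have "\<dots> = (m - 2) * ((x\<^sup>2 + x) * (y\<^sup>2 + y)) * (b * c)"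
      using m by simp
    finally show ?thesis by (simp add: power2_eq_square algebra_simps)
  qed
  have "(x + 1) * (y + 1) * (m + 2) * ((x * b + (y + 2) * a) * ((x + 2) * d + y * c)) =
    (x + 1) * (y + 1) * (m + 2) * (x * (x + 2) * (b * d)) +
    (x + 1) * (y + 1) * (m + 2) * (y * (y + 2) * (a * c)) +
    (x + 1) * (y + 1) * (m + 2) * (x * y * (b * c) + (x + 2) * (y + 2) * (a * d))"
    by (simp add: algebra_simps)
  also have "\<dots> \<le> x * y * m * ((x + 1)\<^sup>2 * c\<^sup>2) + x * y * m * ((y + 1)\<^sup>2 * b\<^sup>2)
      + x * y * m * (2 * (x + 1) * (y + 1) * (b * c))"
    using cc bb bc by linarith
  also have "\<dots> = x * y * m * ((x + 1) * c + (y + 1) * b)\<^sup>2"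
    by (simp add: power2_eq_square algebra_simps)
  finally show ?thesis .
qed

text \<open>Since \<open>(n choose (i - 1)) (n choose (i + 1)) / (n choose i)^2 = i j / ((i + 1) (j
  + 1))\<close>, this is log-concavity of the quotients by binomials, with extra factor
  \<open>(n + 2) / n\<close>.\<close>

lemma eulerian_log_concave:
  assumes "i + j = n" "1 \<le> i" "1 \<le> j"
  shows "(real i + 1) * (real j + 1) * (real n + 2) *
      (real_of_int (eulerian (Suc n) (i - 1)) * real_of_int (eulerian (Suc n) (i + 1)))
    \<le> real i * real j * real n * (real_of_int (eulerian (Suc n) i))\<^sup>2"
  using assms
proof (induction n arbitrary: i j)
  case (Suc n)
  show ?case
  \<comment> \<open>\<open>log_concave_step\<close> requires \<open>x + y \<ge> 3\<close>, so the
    row with \<open>i = j = 1\<close> is checked directly.\<close>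
  proof (cases "n = 1")
    case True
    then have "i = 1" "j = 1" using Suc.prems by auto
    then show ?thesis using True by (simp add: eulerian.simps(2) eulerian_step_def)
  next
    case False
    let ?A = "\<lambda>k. real_of_int (eulerian (Suc n) k)"
    obtain k l where kl: "i = Suc k" "j = Suc l" using Suc.prems by (metis Suc_le_D One_nat_def)
    with Suc.prems have n: "n = Suc (k + l)" by simp
    \<comment> \<open>The entry left of index \<open>0\<close> must be zero; truncated subtraction
      would give \<open>?A 0\<close> instead.\<close>
    define a where "a = (if k = 0 then 0 else ?A (k - 1))"
    have rec: "real_of_int (eulerian (Suc (Suc n)) (Suc k)) = (real i + 1) * ?A (Suc k) + (real j + 1) * ?A k"
      "real_of_int (eulerian (Suc (Suc n)) (Suc (Suc k))) = (real i + 2) * ?A (Suc (Suc k)) + real j * ?A (Suc k)"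
      unfolding eulerian_Suc_Suc by (simp_all add: kl n algebra_simps)
    have rec0: "real_of_int (eulerian (Suc (Suc n)) k) = real i * ?A k + (real j + 2) * a"
    proof (cases k)
      case (Suc k')
      then show ?thesis using eulerian_Suc_Suc[of "Suc n" k']
        by (simp add: kl n a_def algebra_simps)
    qed (simp add: a_def kl)
    have H1: "(real i + 1) * real j * (real i + real j + 1) * (?A k * ?A (Suc (Suc k)))
      \<le> real i * (real j - 1) * (real i + real j - 1) * (?A (Suc k))\<^sup>2"
    proof (cases "l = 0")
      case True
      then show ?thesis using eulerian_eq_0[of "Suc n" "Suc (Suc k)"] kl n by (simp)
    next
      case False
      with Suc.IH[of "Suc k" l] show ?thesis by (simp add: kl n add_ac)
    qed
    have H2: "real i * (real j + 1) * (real i + real j + 1) * (a * ?A (Suc k))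
      \<le> (real i - 1) * real j * (real i + real j - 1) * (?A k)\<^sup>2"
    proof (cases "k = 0")
      case True
      then show ?thesis by (simp add: a_def kl)
    next
      case False
      with Suc.IH[of k "Suc l"] show ?thesis by (simp add: a_def kl n add_ac)
    qed
    have "(real i + 1) * (real j + 1) * (real i + real j + 2) *
        ((real i * ?A k + (real j + 2) * a) * ((real i + 2) * ?A (Suc (Suc k)) + real j * ?A (Suc k)))
      \<le> real i * real j * (real i + real j) * ((real i + 1) * ?A (Suc k) + (real j + 1) * ?A k)\<^sup>2"
    proof (rule log_concave_step[OF _ _ _ _ _ _ _ H1 H2])
      show "0 \<le> a" by (simp add: a_def eulerian_nonneg)
      show "0 < ?A k" "0 < ?A (Suc k)" using eulerian_pos n by (simp_all)
      show "3 \<le> real i + real j" using False kl n by linarith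
    qed (simp_all add: kl eulerian_nonneg)
    moreover have "real (Suc n) = real i + real j" using kl n by simp
    ultimately show ?thesis by (simp only: kl diff_Suc_Suc diff_zero add_Suc_right add_0_right One_nat_def rec rec0)
  qed
qed simp

section \<open>Size of the signed counts\<close>

lemma eulerian_Suc_1: "eulerian (Suc n) 1 = 2 * eulerian n 1 + int n"
  using eulerian_Suc_Suc[of n 0] by simp

lemma eulerian_1_ge: "9 \<le> n \<Longrightarrow> 4 * (int n)\<^sup>2 \<le> eulerian n 1"
proof (induction n rule: dec_induct)
  case base
  show ?case by code_simp
next
  case (step n)
  have "9 * int n \<le> int n * int n" using step(1) by (intro mult_right_mono) auto
  then show ?case unfolding eulerian_Suc_1 power2_eq_square using step
    by (simp only: of_nat_Suc power2_eq_square algebra_simps)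
qed

text \<open>Bounds the excedance perturbation. In the interior both coefficients of the recurrence
  are at least \<open>2\<close>, so Pascal's rule yields the factor
  \<open>4 n \<ge> 2 (n + 1)\<close>.\<close>

lemma eulerian_ge_binomial:
  "7 \<le> n \<Longrightarrow> \<forall>k\<in>{1..n - 2}. 2 * int n * int ((n - 1) choose k) \<le> eulerian n k"
proof (induction n rule: dec_induct)
  case base
  show ?case by code_simp
next
  case (step n)
  show ?case
  proof
    fix k assume k: "k \<in> {1..Suc n - 2}"
    then obtain j where j: "k = Suc j" by (cases k) auto
    obtain N where N: "n = Suc N" using step by (cases n) auto
    have IH: "2 * int n * int (N choose l) \<le> eulerian n l" if "1 \<le> l" "l < N" for l
      using step.IH that by (auto simp: N)
    have rec: "eulerian (Suc n) k = (int j + 2) * eulerian n (Suc j) + (int n - int j) * eulerian n j"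
      unfolding j by (rule eulerian_Suc_Suc)
    \<comment> \<open>For the two extreme \<open>k\<close>, where one parent entry is an end entry
      \<open>1\<close> outside the induction hypothesis.\<close>
    have quad: "2 * (int n + 1) * int n \<le> 4 * int n * int N + int n"
      using mult_right_mono[of "2 * (int n + 1)" "4 * int N + 1" "int n"] N step.hyps(1)
      by (simp add: algebra_simps)
    consider "j = 0" | "Suc j = N" "j \<noteq> 0" | "1 \<le> j" "Suc j < N" using k j N by force
    then have "2 * int (Suc n) * int (n choose Suc j) \<le> eulerian (Suc n) k"
    proof cases
      case 1
      then show ?thesis using IH[of 1] quad step.hyps N unfolding rec
        by (simp add: algebra_simps)
    next
      case 2
      then have "n choose Suc j = n" "N choose j = N" "eulerian n (Suc j) = 1"
        "int j + 2 = int n" "int n - int j = 2"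
        using N eulerian_last[of N] binomial_symmetric[of "Suc j" n] binomial_symmetric[of j N] by auto
      then show ?thesis using IH[of j] 2 quad unfolding rec
        by (simp add: algebra_simps)
    next
      case 3
      have "4 * int n * int (n choose Suc j) =
          2 * (2 * int n * int (N choose Suc j)) + 2 * (2 * int n * int (N choose j))"
        by (simp add: N algebra_simps)
      also have "\<dots> \<le> 2 * eulerian n (Suc j) + 2 * eulerian n j"
        using IH[of "Suc j"] IH[of j] 3 by auto
      also have "\<dots> \<le> eulerian (Suc n) k"
        unfolding rec using 3 N eulerian_nonneg by (intro add_mono mult_right_mono) auto
      finally have "4 * int n * int (n choose Suc j) \<le> eulerian (Suc n) k" .
      moreover have "2 * int (Suc n) * int (n choose Suc j) \<le> 4 * int n * int (n choose Suc j)"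
        using N by (intro mult_right_mono) auto
      ultimately show ?thesis by linarith
    qed
    then show "2 * int (Suc n) * int ((Suc n - 1) choose k) \<le> eulerian (Suc n) k"
      by (simp only: j diff_Suc_1)
  qed
qed

section \<open>Bounds for the signed Eulerian numbers\<close>

lemma signed_eulerian_0: "signed_eulerian n 0 = 1"
  by (induction n rule: induct_nat_012) (auto simp: eulerian_step_def)

lemma signed_eulerian_eq_0: "n \<le> k \<Longrightarrow> 0 < k \<Longrightarrow> signed_eulerian n k = 0"
proof (induction n arbitrary: k rule: induct_nat_012)
  case (ge2 n)
  have "eulerian_step n (signed_eulerian n) l = 0" if "n < l" for l
  proof -
    have "l = Suc n \<or> signed_eulerian n (l - 1) = 0"
      using that ge2.IH(1) by (cases "l = Suc n") auto
    moreover have "signed_eulerian n l = 0" using that ge2.IH(1) by simp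
    ultimately show ?thesis by (auto simp: eulerian_step_def)
  qed
  then show ?case using ge2.prems by auto
qed auto

lemma signed_eulerian_last: "\<bar>signed_eulerian (Suc n) n\<bar> = 1"
proof (induction n rule: induct_nat_012)
  case (ge2 n)
  then show ?case
    by (simp add: eulerian_step_def signed_eulerian_eq_0)
qed (auto simp: eulerian_step_def)

declare signed_eulerian.simps(3) [simp del]

text \<open>The Eulerian step of the signed row \<open>n\<close> is compared with row
  \<open>n + 1\<close> of the Eulerian numbers; the factor \<open>1 - t\<close> then adds two
  neighbouring bounds. Since end entries are \<open>1\<close> in absolute value and violate the
  hypothesis, the places next to them are treated separately.\<close>

lemma signed_eulerian_bound_step:
  assumes n: "8 \<le> n"
    and IH: "\<And>k. 1 \<le> k \<Longrightarrow> k + 2 \<le> n \<Longrightarrow> 2 * int n * \<bar>signed_eulerian n k\<bar> \<le> eulerian n k"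
    and k: "1 \<le> k" "k \<le> n"
  shows "2 * int (n + 2) * \<bar>signed_eulerian (Suc (Suc n)) k\<bar> \<le> eulerian (Suc (Suc n)) k"
proof -
  let ?G = "\<lambda>k. \<bar>eulerian_step n (signed_eulerian n) k\<bar>"
  let ?A = "eulerian (Suc n)"
  obtain N where N: "n = Suc N" using n by (cases n) auto
  have A1: "4 * (int n + 1)\<^sup>2 \<le> ?A 1"
    using eulerian_1_ge[of "Suc n"] n by (simp add: add_ac)
  have A1': "?A N = ?A 1"
    by (rule eulerian_symmetric) (simp add: N)
  have G0: "?G 0 = 1" by (simp add: eulerian_step_def signed_eulerian_0)
  have Gn: "?G n = 1"
    using signed_eulerian_last[of N] signed_eulerian_eq_0[of n n] by (simp add: eulerian_step_def N)
  have G: "2 * int n * ?G (Suc j) \<le> (int j + 2) * (2 * int n * \<bar>signed_eulerian n (Suc j)\<bar>)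
      + (int n - int j) * (2 * int n * \<bar>signed_eulerian n j\<bar>)" if "j < n" for j
  proof -
    have "?G (Suc j) \<le> (int j + 2) * \<bar>signed_eulerian n (Suc j)\<bar> + (int n - int j) * \<bar>signed_eulerian n j\<bar>"
      using that abs_triangle_ineq[of "(int j + 2) * signed_eulerian n (Suc j)" "(int n - int j) * signed_eulerian n j"]
      by (simp add: eulerian_step_def abs_mult add_ac)
    then have "2 * int n * ?G (Suc j) \<le> 2 * int n * ((int j + 2) * \<bar>signed_eulerian n (Suc j)\<bar> + (int n - int j) * \<bar>signed_eulerian n j\<bar>)"
      by (intro mult_left_mono) auto
    then show ?thesis by (simp add: algebra_simps)
  qed
  have G1: "2 * int n * ?G 1 \<le> ?A 1 + 2 * (int n)\<^sup>2"
  proof -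
    have "2 * int n * ?G 1 \<le> 2 * (2 * int n * \<bar>signed_eulerian n 1\<bar>) + 2 * (int n)\<^sup>2"
      using G[of 0] n by (simp add: signed_eulerian_0 power2_eq_square mult_ac)
    moreover have "?A 1 = 2 * eulerian n 1 + int n" by (rule eulerian_Suc_1)
    ultimately show ?thesis using IH[of 1] n by linarith
  qed
  have GN: "2 * int n * ?G N \<le> ?A N + 2 * (int n)\<^sup>2"
  proof -
    obtain M where M: "N = Suc M" using n N by (cases N) auto
    have "2 * int n * ?G N \<le> 2 * (2 * int n * \<bar>signed_eulerian n M\<bar>) + 2 * (int n)\<^sup>2"
      using G[of M] signed_eulerian_last[of N] by (simp add: N M power2_eq_square algebra_simps)
    moreover have "?A N = int n * eulerian n N + 2 * eulerian n M"
      using eulerian_Suc_Suc[of n M] by (simp add: N M)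
    moreover have "eulerian n N = 1" using eulerian_last[of N] N by simp
    ultimately show ?thesis using IH[of M] n N M by simp
  qed
  have sq: "2 * (int n)\<^sup>2 \<le> ?A 1"
  proof -
    have "(int n)\<^sup>2 \<le> (int n + 1)\<^sup>2" by (intro power_mono) auto
    with A1 zero_le_power2[of "int n + 1"] show ?thesis by linarith
  qed
  \<comment> \<open>In the interior the factor \<open>2\<close> is a loss; it is there to absorb the
    extra \<open>2 n^2\<close> at \<open>k = 1\<close> and \<open>k = N\<close>.\<close>
  have Gk: "2 * int n * ?G k \<le> 2 * ?A k" if "1 \<le> k" "k \<le> N" for k
  proof -
    consider "k = 1" | "k = N" | "1 < k" "k < N" using \<open>1 \<le> k\<close> \<open>k \<le> N\<close> by linarith
    then show ?thesis
    proof cases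
      case 1
      then show ?thesis using G1 sq by simp
    next
      case 2
      then show ?thesis using GN sq A1' by simp
    next
      case 3
      then obtain j where j: "k = Suc j" "1 \<le> j" "j + 2 \<le> N" by (cases k) auto
      have "2 * int n * ?G k \<le> (int j + 2) * (2 * int n * \<bar>signed_eulerian n (Suc j)\<bar>)
        + (int n - int j) * (2 * int n * \<bar>signed_eulerian n j\<bar>)"
        unfolding j(1) using j N by (intro G) auto
      also have "\<dots> \<le> (int j + 2) * eulerian n (Suc j) + (int n - int j) * eulerian n j"
        using j N IH[of j] IH[of "Suc j"] by (intro add_mono mult_left_mono) auto
      also have "\<dots> = ?A k" unfolding j(1) by (rule eulerian_Suc_Suc[symmetric])
      finally show ?thesis using eulerian_nonneg[of "Suc n" k] by linarith
    qed
  qed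
  \<comment> \<open>At \<open>k = 1\<close> and \<open>k = n\<close> one of the two summands is
    \<open>?G 0\<close> or \<open>?G n\<close>, equal to \<open>1\<close>, which contributes the
    \<open>2 n\<close>. The quadratic terms are absorbed by \<open>A1\<close>.\<close>
  have edge: "2 * int (n + 2) * \<bar>signed_eulerian (Suc (Suc n)) k\<bar> \<le> eulerian (Suc (Suc n)) k"
    if D: "2 * int n * \<bar>signed_eulerian (Suc (Suc n)) k\<bar> \<le> ?A 1 + 2 * (int n)\<^sup>2 + 2 * int n"
      and A: "eulerian (Suc (Suc n)) k = eulerian (Suc (Suc n)) 1"
  proof -
    have "int n * (2 * int (n + 2) * \<bar>signed_eulerian (Suc (Suc n)) k\<bar>) =
        (int n + 2) * (2 * int n * \<bar>signed_eulerian (Suc (Suc n)) k\<bar>)" by simp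
    also have "\<dots> \<le> (int n + 2) * (?A 1 + 2 * (int n)\<^sup>2 + 2 * int n)"
      by (rule mult_left_mono[OF D]) simp
    also have "\<dots> \<le> int n * (2 * ?A 1 + int (Suc n))"
    proof -
      have "(int n - 2) * (4 * (int n + 1)\<^sup>2) \<le> (int n - 2) * ?A 1"
        using n by (intro mult_left_mono[OF A1]) auto
      moreover have "(int n + 2) * (2 * (int n)\<^sup>2 + 2 * int n) \<le> (int n - 2) * (4 * (int n + 1)\<^sup>2)"
      proof -
        have "8 * int n \<le> int n * int n" using n by (intro mult_right_mono) auto
        then have "(int n + 2) * int n \<le> (int n - 2) * (2 * (int n + 1))"
        proof -
          have "(int n - 2) * (2 * (int n + 1)) - (int n + 2) * int n = int n * int n - 4 * int n - 4"
            by (simp add: algebra_simps)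
          with \<open>8 * int n \<le> int n * int n\<close> n show ?thesis by linarith
        qed
        then have "2 * (int n + 1) * ((int n + 2) * int n) \<le> 2 * (int n + 1) * ((int n - 2) * (2 * (int n + 1)))"
          by (intro mult_left_mono) auto
        then show ?thesis by (simp add: power2_eq_square algebra_simps)
      qed
      moreover have "int n * (2 * ?A 1 + int (Suc n)) - (int n + 2) * (?A 1 + 2 * (int n)\<^sup>2 + 2 * int n)
        = (int n - 2) * ?A 1 - (int n + 2) * (2 * (int n)\<^sup>2 + 2 * int n) + int n * (int n + 1)"
        by (simp add: algebra_simps)
      moreover have "0 \<le> int n * (int n + 1)" by simp
      ultimately show ?thesis by linarith
    qed
    also have "\<dots> = int n * eulerian (Suc (Suc n)) k"
      unfolding A eulerian_Suc_1[of "Suc n"] ..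
    finally show ?thesis using n by simp
  qed
  have D: "\<bar>signed_eulerian (Suc (Suc n)) k\<bar> \<le> ?G k + ?G (k - 1)"
    using k by (simp add: signed_eulerian.simps(3) abs_triangle_ineq4)
  then have D': "2 * int n * \<bar>signed_eulerian (Suc (Suc n)) k\<bar> \<le> 2 * int n * ?G k + 2 * int n * ?G (k - 1)"
    using mult_left_mono[OF D, of "2 * int n"] by (simp add: distrib_left)
  consider "k = 1" | "k = n" | "1 < k" "k < n" using k by linarith
  then show ?thesis
  proof cases
    case 1
    show ?thesis
    proof (rule edge)
      show "2 * int n * \<bar>signed_eulerian (Suc (Suc n)) k\<bar> \<le> ?A 1 + 2 * (int n)\<^sup>2 + 2 * int n"
        using D' G0 G1 1 by simp
    qed (simp add: 1)
  next
    case 2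
    show ?thesis
    proof (rule edge)
      show "2 * int n * \<bar>signed_eulerian (Suc (Suc n)) k\<bar> \<le> ?A 1 + 2 * (int n)\<^sup>2 + 2 * int n"
        using D' Gn GN 2 A1' N by simp
      show "eulerian (Suc (Suc n)) k = eulerian (Suc (Suc n)) 1"
        by (rule eulerian_symmetric) (simp add: 2)
    qed
  next
    case 3
    then obtain j where j: "k = Suc j" "1 \<le> j" "j < N" using N by (cases k) auto
    let ?S = "?A (Suc j) + ?A j"
    have "2 * int n * \<bar>signed_eulerian (Suc (Suc n)) k\<bar> \<le> 2 * ?S"
      using D' Gk[of "Suc j"] Gk[of j] j by simp
    then have "(int n + 2) * (2 * int n * \<bar>signed_eulerian (Suc (Suc n)) k\<bar>) \<le> (int n + 2) * (2 * ?S)"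
      by (intro mult_left_mono) auto
    \<comment> \<open>Here \<open>2 (n + 2) \<le> 3 n\<close>, and away from the edges both
      coefficients of the next recurrence are at least \<open>3\<close>.\<close>
    also have "\<dots> \<le> int n * (3 * ?S)"
    proof -
      have "((int n + 2) * 2) * ?S \<le> (int n * 3) * ?S"
        using n eulerian_nonneg[of "Suc n"] by (intro mult_right_mono add_nonneg_nonneg) auto
      then show ?thesis by (simp only: mult.assoc)
    qed
    also have "3 * ?S \<le> eulerian (Suc (Suc n)) k"
    proof -
      have "3 * ?S = 3 * ?A (Suc j) + 3 * ?A j" by simp
      also have "\<dots> \<le> (int j + 2) * ?A (Suc j) + (int (Suc n) - int j) * ?A j"
        using j N eulerian_nonneg by (intro add_mono mult_right_mono) auto
      finally show ?thesis unfolding j(1) eulerian_Suc_Suc[of "Suc n" j] .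
    qed
    then have "int n * (3 * ?S) \<le> int n * eulerian (Suc (Suc n)) k" by (intro mult_left_mono) auto
    finally have "(int n + 2) * (2 * int n * \<bar>signed_eulerian (Suc (Suc n)) k\<bar>) \<le> int n * eulerian (Suc (Suc n)) k" .
    moreover have "(int n + 2) * (2 * int n * \<bar>signed_eulerian (Suc (Suc n)) k\<bar>) =
        int n * (2 * int (n + 2) * \<bar>signed_eulerian (Suc (Suc n)) k\<bar>)" by simp
    ultimately have "int n * (2 * int (n + 2) * \<bar>signed_eulerian (Suc (Suc n)) k\<bar>) \<le> int n * eulerian (Suc (Suc n)) k"
      by (simp only:)
    then show ?thesis using n by simp
  qed
qed

lemma signed_eulerian_bound:
  "8 \<le> n \<Longrightarrow> 1 \<le> k \<Longrightarrow> k + 2 \<le> n \<Longrightarrow> 2 * int n * \<bar>signed_eulerian n k\<bar> \<le> eulerian n k"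
proof (induction n arbitrary: k rule: less_induct)
  case (less n)
  \<comment> \<open>The recurrence advances by two, so there are two base cases.\<close>
  consider "n = 8" | "n = 9" | "10 \<le> n" using less.prems by linarith
  then show ?case
  proof cases
    case 1
    have "\<forall>k\<in>{1..6}. 2 * int 8 * \<bar>signed_eulerian 8 k\<bar> \<le> eulerian 8 k" by code_simp
    then show ?thesis using less.prems 1 by simp
  next
    case 2
    have "\<forall>k\<in>{1..7}. 2 * int 9 * \<bar>signed_eulerian 9 k\<bar> \<le> eulerian 9 k" by code_simp
    then show ?thesis using less.prems 2 by simp
  next
    case 3
    define N where "N = n - 2"
    with 3 have N: "n = Suc (Suc N)" by simp
    have "2 * int (N + 2) * \<bar>signed_eulerian (Suc (Suc N)) k\<bar> \<le> eulerian (Suc (Suc N)) k"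
      using less 3 N by (intro signed_eulerian_bound_step) auto
    then show ?thesis by (simp add: N)
  qed
qed

text \<open>The first entry at least doubles, so its square gains a factor \<open>4\<close>: three
  parts cover \<open>3 A(n, 2)\<close>, and the fourth covers \<open>(n - 1) A(n, 1)\<close> because
  \<open>7 (n - 1) \<le> A(n, 1)\<close>.\<close>

lemma eulerian_1_sq_ge: "8 \<le> n \<Longrightarrow> 7 * eulerian n 2 \<le> (eulerian n 1)\<^sup>2"
proof (induction n rule: dec_induct)
  case base
  show ?case by code_simp
next
  case (step n)
  let ?a = "eulerian n 1"
  have a: "7 * (int n - 1) \<le> ?a"
  proof -
    have "2 * int n * (int n - 1) \<le> ?a"
      using bspec[OF eulerian_ge_binomial[of n], of 1] step.hyps(1) by (simp add: of_nat_diff)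
    moreover have "7 * (int n - 1) \<le> 2 * int n * (int n - 1)"
      using step.hyps(1) by (intro mult_right_mono) auto
    ultimately show ?thesis by linarith
  qed
  have "7 * eulerian (Suc n) 2 = 3 * (7 * eulerian n 2) + 7 * (int n - 1) * ?a"
    using eulerian_Suc_Suc[of n 1] by (simp add: numeral_2_eq_2)
  also have "\<dots> \<le> 3 * ?a\<^sup>2 + ?a * ?a"
    using step.IH a eulerian_nonneg by (intro add_mono mult_right_mono) auto
  also have "\<dots> = (2 * ?a)\<^sup>2" by (simp add: power2_eq_square)
  also have "\<dots> \<le> (eulerian (Suc n) 1)\<^sup>2"
    unfolding eulerian_Suc_1 using eulerian_nonneg[of n 1] by (intro power_mono) auto
  finally show ?case .
qed

section \<open>Ultra-synchronisation\<close>

text \<open>One radius for all four sequences: the binomial is the excedance deviation, the other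
  entry the descent deviation.\<close>

definition eulerian_error :: "nat \<Rightarrow> nat \<Rightarrow> int" where
  "eulerian_error n k = max (int ((n - 1) choose k)) \<bar>signed_eulerian n k\<bar>"

lemma eulerian_error_bound:
  assumes "8 \<le> n" "1 \<le> k" "k + 2 \<le> n"
  shows "2 * int n * eulerian_error n k \<le> eulerian n k"
  using eulerian_ge_binomial[of n] signed_eulerian_bound[OF assms] assms
  by (auto simp: eulerian_error_def max_def)

text \<open>Relative errors of \<open>1 / (2 n)\<close> fit into the factor
  \<open>(n + 1) / (n - 1)\<close>, because \<open>(2 n + 1)^2 (n - 1) = 4 n^3 - 3 n - 1\<close> and
  \<open>(2 n - 1)^2 (n + 1) = 4 n^3 - 3 n + 1\<close>.\<close>

lemma perturbed_log_concave:
  fixes A B C a b c x y n :: real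
  assumes n: "1 \<le> n" and xy: "1 \<le> x" "1 \<le> y"
    and nn: "0 \<le> A" "0 \<le> B" "0 \<le> C" "0 \<le> a" "0 \<le> c"
    and A: "2 * n * a \<le> A" and B: "2 * n * b \<le> B" and C: "2 * n * c \<le> C"
    and lc: "(x + 1) * (y + 1) * (n + 1) * (A * C) \<le> x * y * (n - 1) * B\<^sup>2"
  shows "(x + 1) * (y + 1) * ((C + c) * (A + a)) \<le> x * y * (B - b)\<^sup>2"
proof -
  have "(4 * n\<^sup>2 * (n + 1)) * ((x + 1) * (y + 1) * ((C + c) * (A + a))) =
    (n + 1) * ((x + 1) * (y + 1)) * ((2 * n * (C + c)) * (2 * n * (A + a)))"
    by (simp add: power2_eq_square)
  also have "\<dots> \<le> (n + 1) * ((x + 1) * (y + 1)) * (((2 * n + 1) * C) * ((2 * n + 1) * A))"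
  proof -
    have "2 * n * (C + c) \<le> (2 * n + 1) * C" "2 * n * (A + a) \<le> (2 * n + 1) * A"
      using A C by (simp_all add: algebra_simps)
    then show ?thesis using n xy nn by (intro mult_left_mono mult_mono[of "2 * n * (C + c)"]) auto
  qed
  also have "\<dots> = (2 * n + 1)\<^sup>2 * ((x + 1) * (y + 1) * (n + 1) * (A * C))"
    by (simp add: power2_eq_square)
  also have "\<dots> \<le> (2 * n + 1)\<^sup>2 * (x * y * (n - 1) * B\<^sup>2)"
    by (rule mult_left_mono[OF lc]) simp
  also have "\<dots> = ((2 * n + 1)\<^sup>2 * (n - 1)) * (x * y * B\<^sup>2)" by simp
  also have "\<dots> \<le> ((2 * n - 1)\<^sup>2 * (n + 1)) * (x * y * B\<^sup>2)"
  proof -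
    have "(2 * n + 1)\<^sup>2 * (n - 1) \<le> (2 * n - 1)\<^sup>2 * (n + 1)"
      by (simp add: power2_eq_square algebra_simps)
    then show ?thesis using xy by (intro mult_right_mono) auto
  qed
  also have "\<dots> = (n + 1) * (x * y) * ((2 * n - 1) * B)\<^sup>2"
    by (simp add: power_mult_distrib)
  also have "\<dots> \<le> (n + 1) * (x * y) * (2 * n * (B - b))\<^sup>2"
  proof -
    have "(2 * n - 1) * B \<le> 2 * n * (B - b)" using B by (simp add: algebra_simps)
    then show ?thesis using n xy nn by (intro mult_left_mono power_mono) auto
  qed
  also have "\<dots> = (4 * n\<^sup>2 * (n + 1)) * (x * y * (B - b)\<^sup>2)"
    by (simp add: power_mult_distrib)
  finally show ?thesis
    by (rule mult_left_le_imp_le) (use n in \<open>auto simp: zero_less_mult_iff\<close>)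
qed

text \<open>The case \<open>i = 1\<close>, \<open>j = m - 1\<close>, with \<open>A\<close>,
  \<open>B\<close> the entries at \<open>1\<close> and \<open>2\<close>. Entry \<open>0\<close> plus
  its error is \<open>2\<close>, so the left factor is \<open>2 * m * 2\<close>. The constant
  \<open>7\<close> suffices, as \<open>4 m * 17/16 \<le> (m - 1) * 7 * 225/256\<close> for
  \<open>m \<ge> 7\<close>.\<close>

lemma perturbed_log_concave_edge:
  fixes A B a b m :: real
  assumes m: "7 \<le> m" and nn: "0 \<le> A" "0 \<le> B" and A: "16 * a \<le> A" and B: "16 * b \<le> B"
    and sq: "7 * B \<le> A\<^sup>2"
  shows "4 * m * (B + b) \<le> (m - 1) * (A - a)\<^sup>2"
proof -
  have "4 * m * (B + b) \<le> 4 * m * (17 / 16 * B)"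
    using m B by (intro mult_left_mono) auto
  also have "\<dots> \<le> (m - 1) * (225 / 256 * (7 * B))"
    using mult_right_mono[of "4 * m * (17 / 16)" "(m - 1) * (225 / 256 * 7)" B] m nn
    by (simp add: mult_ac)
  also have "\<dots> \<le> (m - 1) * (225 / 256 * A\<^sup>2)"
    using m sq by (intro mult_left_mono) auto
  also have "\<dots> = (m - 1) * (15 / 16 * A)\<^sup>2" by (simp add: power2_eq_square)
  also have "\<dots> \<le> (m - 1) * (A - a)\<^sup>2"
    using m nn A by (intro mult_left_mono power_mono) auto
  finally show ?thesis .
qed

text \<open>The second conjunct keeps \<open>A i - e i\<close> nonnegative, so that a lower bound
  for the minimum may be squared.\<close>

lemma eulerian_perturbed:
  assumes ij: "i + j = n - 1" "1 \<le> i" "1 \<le> j" and n: "5 \<le> n"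
  defines "A \<equiv> \<lambda>k. real_of_int (eulerian n k)" and "e \<equiv> \<lambda>k. real_of_int (eulerian_error n k)"
  shows "(real i + 1) * (real j + 1) * ((A (i + 1) + e (i + 1)) * (A (i - 1) + e (i - 1)))
      \<le> real i * real j * (A i - e i)\<^sup>2 \<and> e i \<le> A i"
proof (cases "8 \<le> n")
  case True
  obtain N where N: "n = Suc N" using n by (cases n) auto
  have A0: "A 0 = 1" "A N = 1" and e0: "e 0 = 1" "e N = 1"
    using signed_eulerian_last[of N]
    by (simp_all add: A_def e_def N eulerian_last eulerian_error_def signed_eulerian_0)
  have Ann: "0 \<le> A k" for k by (simp add: A_def eulerian_nonneg)
  have enn: "0 \<le> e k" for k by (simp add: e_def eulerian_error_def)
  have Ae: "2 * real n * e k \<le> A k" if "1 \<le> k" "k < N" for k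
  proof -
    have "real_of_int (2 * int n * eulerian_error n k) \<le> real_of_int (eulerian n k)"
      using eulerian_error_bound[OF True] that N by (subst of_int_le_iff) simp
    then show ?thesis by (simp add: A_def e_def)
  qed
  have Ae16: "16 * e k \<le> A k" if "1 \<le> k" "k < N" for k
    using Ae[OF that] mult_right_mono[of 16 "2 * real n" "e k"] True enn[of k] by linarith
  have ei: "e i \<le> A i" using Ae16[of i] enn[of i] ij N by simp
  have sym: "A k = A l" if "k + l = N" for k l
    unfolding A_def N using eulerian_symmetric[OF that] by simp
  have "real_of_int (7 * eulerian n 2) \<le> real_of_int ((eulerian n 1)\<^sup>2)"
    using eulerian_1_sq_ge[OF True] by (subst of_int_le_iff)
  then have sq: "7 * A 2 \<le> (A 1)\<^sup>2" by (simp add: A_def)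
  consider "i = 1" | "j = 1" | "2 \<le> i" "2 \<le> j" using ij by linarith
  then have "(real i + 1) * (real j + 1) * ((A (i + 1) + e (i + 1)) * (A (i - 1) + e (i - 1)))
      \<le> real i * real j * (A i - e i)\<^sup>2"
  proof cases
    case 1
    then have j: "real j = real N - 1" using ij N by auto
    have "4 * real N * (A 2 + e 2) \<le> (real N - 1) * (A 1 - e 1)\<^sup>2"
      using True N Ann Ae16[of 1] Ae16[of 2] sq by (intro perturbed_log_concave_edge) auto
    then show ?thesis by (simp add: 1 j A0 e0 numeral_2_eq_2 mult_ac)
  next
    case 2
    then have i: "real i = real N - 1" "i + 1 = N" "i - 1 = N - 2" "i = N - 1" using ij N by auto
    \<comment> \<open>Reflection carries the inequality between entries \<open>1\<close> and
      \<open>2\<close> to the right end of the row.\<close>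
    have "A (N - 1) = A 1" "A (N - 2) = A 2" using True N by (auto intro!: sym)
    then have "4 * real N * (A (N - 2) + e (N - 2)) \<le> (real N - 1) * (A (N - 1) - e (N - 1))\<^sup>2"
      using True N Ann Ae16[of "N - 1"] Ae16[of "N - 2"] sq by (intro perturbed_log_concave_edge) auto
    then show ?thesis unfolding i(2,3) i(1) by (simp add: 2 i(4) A0 e0 mult_ac)
  next
    case 3
    show ?thesis
    proof (rule perturbed_log_concave)
      show "(real i + 1) * (real j + 1) * (real n + 1) * (A (i - 1) * A (i + 1))
        \<le> real i * real j * (real n - 1) * (A i)\<^sup>2"
        using eulerian_log_concave[of i j N] ij N by (simp add: A_def add_ac)
      show "2 * real n * e (i - 1) \<le> A (i - 1)" "2 * real n * e i \<le> A i"
        "2 * real n * e (i + 1) \<le> A (i + 1)"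
        using 3 ij N by (intro Ae; simp)+
    qed (use 3 ij N Ann enn in auto)
  qed
  with ei show ?thesis by simp
next
  case False
  have table5: "map (eulerian 5) [0, 1, 2, 3, 4] = [1, 26, 66, 26, 1]"
    "map (eulerian_error 5) [0, 1, 2, 3, 4] = [1, 4, 6, 4, 1]" by code_simp+
  have table6: "map (eulerian 6) [0, 1, 2, 3, 4, 5] = [1, 57, 302, 302, 57, 1]"
    "map (eulerian_error 6) [0, 1, 2, 3, 4, 5] = [1, 5, 10, 10, 5, 1]" by code_simp+
  have table7: "map (eulerian 7) [0, 1, 2, 3, 4, 5, 6] = [1, 120, 1191, 2416, 1191, 120, 1]"
    "map (eulerian_error 7) [0, 1, 2, 3, 4, 5, 6] = [1, 8, 19, 20, 19, 8, 1]" by code_simp+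
  consider "n = 5" | "n = 6" | "n = 7" using False n by linarith
  then show ?thesis
  proof cases
    case 1
    with ij have "(i, j) \<in> {(1, 3), (2, 2), (3, 1)}" by auto
    with 1 table5 show ?thesis by (auto simp: A_def e_def simp flip: numeral_2_eq_2)
  next
    case 2
    with ij have "(i, j) \<in> {(1, 4), (2, 3), (3, 2), (4, 1)}" by auto
    with 2 table6 show ?thesis by (auto simp: A_def e_def simp flip: numeral_2_eq_2)
  next
    case 3
    with ij have "(i, j) \<in> {(1, 5), (2, 4), (3, 3), (4, 2), (5, 1)}" by auto
    with 3 table7 show ?thesis by (auto simp: A_def e_def simp flip: numeral_2_eq_2)
  qed
qed

text \<open>Every sequence lies within \<open>e / 2\<close> of \<open>A / 2\<close>, so the maxima
  are at most \<open>(A + e) / 2\<close> and the minimum is at least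
  \<open>(A - e) / 2\<close>.\<close>

lemma ultra_synchronised_atI:
  fixes A e :: "nat \<Rightarrow> real"
  assumes Xs: "Xs \<noteq> []" and ij: "i + j = m" "1 \<le> i" "1 \<le> j"
    and nn: "\<And>X k. X \<in> set Xs \<Longrightarrow> 0 \<le> X k"
    and close: "\<And>X k. X \<in> set Xs \<Longrightarrow> \<bar>2 * X k - A k\<bar> \<le> e k"
    and le: "e i \<le> A i"
    and ineq: "(real i + 1) * (real j + 1) * ((A (i + 1) + e (i + 1)) * (A (i - 1) + e (i - 1)))
      \<le> real i * real j * (A i - e i)\<^sup>2"
  shows "ultra_synchronised_at m Xs i"
proof -
  define c c1 c0 where "c = real (m choose i)" and "c1 = real (m choose (i + 1))"
    and "c0 = real (m choose (i - 1))"
  have pos: "0 < c" "0 < c1" "0 < c0" using ij by (auto simp: c_def c1_def c0_def)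
  \<comment> \<open>Ratios of neighbouring binomials turn the normalisation into the factors
    \<open>(i + 1) (j + 1)\<close> and \<open>i j\<close>.\<close>
  have c1: "(real i + 1) * c1 = real j * c"
  proof -
    have "m - i = j" using ij by simp
    then have "real (Suc i * (m choose Suc i)) = real (j * (m choose i))"
      by (simp only: Suc_times_choose_Suc)
    then show ?thesis by (simp add: c_def c1_def algebra_simps)
  qed
  have c0: "(real j + 1) * c0 = real i * c"
  proof -
    obtain l where l: "i = Suc l" using ij by (cases i) auto
    have "m - l = Suc j" using ij l by simp
    then have "real (Suc l * (m choose Suc l)) = real (Suc j * (m choose l))"
      by (simp only: Suc_times_choose_Suc)
    then show ?thesis by (simp add: c_def c0_def l algebra_simps)
  qed
  let ?max = "\<lambda>k. MAX X\<in>set Xs. X k"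
  have max_le: "?max k \<le> (A k + e k) / 2" for k
  proof -
    have "X k \<le> (A k + e k) / 2" if "X \<in> set Xs" for X
      using close[OF that, of k] by (simp add: abs_le_iff)
    then show ?thesis using Xs by (subst Max_le_iff) auto
  qed
  have max_nn: "0 \<le> ?max k" for k
    using Xs nn[OF hd_in_set[OF Xs], of k] by (subst Max_ge_iff) auto
  have min_ge: "(A i - e i) / 2 \<le> (MIN X\<in>set Xs. X i)"
  proof -
    have "(A i - e i) / 2 \<le> X i" if "X \<in> set Xs" for X
      using close[OF that, of i] by (simp add: abs_le_iff)
    then show ?thesis using Xs by (subst Min_ge_iff) auto
  qed
  have "(?max (i + 1) / c1) * (?max (i - 1) / c0) \<le>
      ((A (i + 1) + e (i + 1)) / 2 / c1) * ((A (i - 1) + e (i - 1)) / 2 / c0)"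
    using pos max_nn max_le order_trans[OF max_nn max_le]
    by (intro mult_mono divide_right_mono divide_nonneg_pos) auto
  also have "\<dots> = ((real i + 1) * (real j + 1) * ((A (i + 1) + e (i + 1)) * (A (i - 1) + e (i - 1)))) / 4
      / (((real i + 1) * c1) * ((real j + 1) * c0))"
    using pos by (simp add: divide_simps)
  also have "\<dots> \<le> (real i * real j * (A i - e i)\<^sup>2) / 4 / (((real i + 1) * c1) * ((real j + 1) * c0))"
    using pos by (intro divide_right_mono[OF divide_right_mono[OF ineq]]) auto
  also have "\<dots> = ((A i - e i) / 2)\<^sup>2 / c\<^sup>2"
    unfolding c0 c1 using pos ij by (simp add: power2_eq_square divide_simps)
  also have "\<dots> \<le> (MIN X\<in>set Xs. X i)\<^sup>2 / c\<^sup>2"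
    using min_ge le by (intro divide_right_mono power_mono) auto
  finally show ?thesis
    by (simp only: ultra_synchronised_at_def c_def c1_def c0_def)
qed

theorem theorem6:
  fixes n :: nat
  assumes "n \<ge> 5"
  shows "ultra_synchronised (n - 1)
    [\<lambda>k. real (B_num n k), \<lambda>k. real (C_num n k), \<lambda>k. real (P_num n k), \<lambda>k. real (Q_num n k)]"
  unfolding ultra_synchronised_def
proof
  fix i assume i: "i \<in> {1..n - 1 - 1}"
  define j where "j = n - 1 - i"
  have ij: "i + j = n - 1" "1 \<le> i" "1 \<le> j" using i by (auto simp: j_def)
  obtain N where N: "n = Suc N" using assms by (cases n) auto
  \<comment> \<open>Both deviations are covered by the common radius; \<open>n = Suc N\<close> fits
    the excedance formula, whose binomial is \<open>N choose k\<close>.\<close>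
  have err: "\<bar>signed_eulerian n k\<bar> \<le> eulerian_error n k"
    "\<bar>(-1) ^ k * int (N choose k)\<bar> \<le> eulerian_error n k" for k
    by (auto simp: eulerian_error_def N abs_mult power_abs)
  have close: "\<bar>2 * int (B_num n k) - eulerian n k\<bar> \<le> eulerian_error n k"
    "\<bar>2 * int (C_num n k) - eulerian n k\<bar> \<le> eulerian_error n k"
    "\<bar>2 * int (P_num n k) - eulerian n k\<bar> \<le> eulerian_error n k"
    "\<bar>2 * int (Q_num n k) - eulerian n k\<bar> \<le> eulerian_error n k" for k
    using err[of k] B_num_eq[of n k] C_num_eq[of n k] P_num_eq[of N k] Q_num_eq[of N k]
    unfolding N by linarith+
  have real_close: "\<bar>2 * real x - real_of_int y\<bar> \<le> real_of_int z" if "\<bar>2 * int x - y\<bar> \<le> z" for x y z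
    using that by linarith
  show "ultra_synchronised_at (n - 1)
    [\<lambda>k. real (B_num n k), \<lambda>k. real (C_num n k), \<lambda>k. real (P_num n k), \<lambda>k. real (Q_num n k)] i"
    using eulerian_perturbed[OF ij assms] close[THEN real_close]
    by (intro ultra_synchronised_atI[OF _ ij, where A = "\<lambda>k. real_of_int (eulerian n k)"
          and e = "\<lambda>k. real_of_int (eulerian_error n k)"]) auto
qed

end
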